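(* Let $T\in\mathcal L(\mathcal H_n)$ be normal with spectral measure $E$, and let $\Omega_{\mathfrak I}^+=\sigma_S(T)\cap\mathbb C_{\mathfrak I}^+$, where $\mathfrak I\in\mathbb S$. For any intrinsic continuous bounded Borel function $f$ (viewed on $\Omega_{\mathfrak I}^+$, with values in $\mathbb C_{\mathfrak I}$), we have $$\sigma_S(\mathbb I(f))\cap\mathbb C_{\mathfrak I}=\overline{f(\sigma_S(T)\cap\mathbb C_{\mathfrak I})}.$$ If $T\in\mathcal B(\mathcal H_n)$ is normal, then this becomes $$\sigma_S(\mathbb I(f))\cap\mathbb C_{\mathfrak I}=f(\sigma_S(T)\cap\mathbb C_{\mathfrak I}).$$
   Context: Let $n\ge1$. $\mathbb R_n$ is the real Clifford algebra (of real dimension $2^n$) generated by $e_1,\dots,e_n$ with $e_i^2=-1$ and $e_ie_j=-e_je_i$ for $i\ne j$; it has basis $e_\alpha=e_{i_1}\cdots e_{i_r}$ for $\alpha=\{i_1<\cdots<i_r\}\subseteq\{1,\dots,n\}$, $e_\emptyset=1$. For $a=\sum_\alpha a_\alpha e_\alpha$ ($a_\alpha\in\mathbb R$): $\mathrm{Re}(a)=a_\emptyset$, $|a|=(\sum_\alpha a_\alpha^2)^{1/2}$, and $a\mapsto\bar a$ is the real-linear map with $\overline{ab}=\bar b\,\bar a$, $\bar 1=1$, $\bar e_j=-e_j$. $\mathcal H$ is a real Hilbert space and $\mathcal H_n=\mathcal H\otimes\mathbb R_n$ is the two-sided Clifford module of elements $x=\sum_\alpha x_\alpha e_\alpha$ ($x_\alpha\in\mathcal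 H$), with $\langle x,y\rangle=\sum_{\alpha,\beta}\bar e_\beta e_\alpha\langle x_\alpha,y_\beta\rangle_{\mathcal H}\in\mathbb R_n$ (so $\langle xa,y\rangle=\langle x,y\rangle a$) and norm $\|x\|=(\sum_\alpha\|x_\alpha\|^2)^{1/2}=(\mathrm{Re}\langle x,x\rangle)^{1/2}$. $\mathcal L(\mathcal H_n)$ is the set of right $\mathbb R_n$-linear operators $T:\mathcal D(T)\to\mathcal H_n$, $\mathcal D(T)$ a right submodule; $\mathcal B(\mathcal H_n)$ is the set of everywhere defined bounded ones. For densely defined $T$, $\mathcal D(T^* )$ is the set of $y$ for which there is $z$ with $\langle Tx,y\rangle=\langle x,z\rangle$ for all $x\in\mathcal D(T)$, and $T^*y=z$. $T$ is normal if it is densely defined and closed, $\mathcal D(T)=\mathcal D(T^* )$ and $TT^*=T^*T$. An imaginary operator is a unitary $J\in\mathcal B(\mathcal H_n)$ with $J^*=-J$. An orthogonal projection is a self-adjoint $P\in\mathcal B(\mathcal H_n)$ with $P^2=P$. $\mathbb R^{n+1}$ is identified with the paravectors $s=s_0+\sum_{j=1}^n s_je_j$. $\mathbb S=\{\sum_{j=1}^n\mathfrak I_je_j:\sum\mathfrak I_j^2=1\}$ (so $\mathfrak I^2=-1$). For $\mathfrak I\in\mathbb S$, $\mathbb C_{\mathfrak I}=\{\lambda_0+\lambda_1\mathfrak I:\lambda_0,\lambda_1\in\mathbb R\}$, $\mathbb C_{\mathfrak I}^+=\{\lambda_0+\lambda_1\mathfrak I:\lambda_1\ge0\}$, $\mathrm{Re}(\lambda)=\lambda_0$,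 $\mathrm{Im}(\lambda)=\lambda_1\in\mathbb R$. With $\mathcal Q_s(T)=T^2-2\mathrm{Re}(s)T+|s|^2I$ on $\mathcal D(T^2)$, $\rho_S(T)$ is the set of $s\in\mathbb R^{n+1}$ such that $\mathcal Q_s(T)$ has trivial kernel, dense range, and bounded inverse $\mathrm{Ran}\,\mathcal Q_s(T)\to\mathcal D(T^2)$; $\sigma_S(T)=\mathbb R^{n+1}\setminus\rho_S(T)$. A set $\Omega\subseteq\mathbb R^{n+1}$ is axially symmetric if $u+v\mathfrak I\in\Omega$ ($u,v\in\mathbb R$, $\mathfrak I\in\mathbb S$) implies $u+v\mathfrak J\in\Omega$ for all $\mathfrak J\in\mathbb S$; $\sigma_S(T)$ is axially symmetric. A function $f$ on an axially symmetric set $\Omega$ is intrinsic if $f(u+\mathfrak Iv)=f_0(u,v)+\mathfrak If_1(u,v)$ for all $u+\mathfrak Iv\in\Omega$, $\mathfrak I\in\mathbb S$, with real-valued $f_0,f_1$ satisfying $f_0(u,-v)=f_0(u,v)$ and $f_1(u,-v)=-f_1(u,v)$. Here $f$ is intrinsic on $\sigma_S(T)$; it maps $\sigma_S(T)\cap\mathbb C_{\mathfrak I}$ into $\mathbb C_{\mathfrak I}$. A spectral measure on a $\sigma$-algebra $\mathscr A$ of subsets of $\Omega$ is a map $E$ from $\mathscr A$ to orthogonal projections on $\mathcal H_n$ that is countably additive (in the strong operator topology) with $E(\Omega)=I$. $J$ is associated with $E$ if $JE(M)=E(M)J$ for all $M$. For a simple function $f=\sum_jc_j\chi_{M_j}$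 (disjoint $M_j$, $c_j\in\mathbb C_{\mathfrak I}$), $\mathbb I(f)=\sum_j\{\mathrm{Re}(c_j)E(M_j)+\mathrm{Im}(c_j)E(M_j)J\}$; for bounded measurable $f$, $\mathbb I(f)\in\mathcal B(\mathcal H_n)$ is the operator norm limit of $\mathbb I(f_j)$ for simple $f_j\to f$ uniformly; for unbounded measurable $f$, $\mathbb I(f)x=\lim_j\mathbb I(f\chi_{M_j})x$ with domain $\{x:\int|f|^2\,d(\mathrm{Re}\langle E(\lambda)x,x\rangle)<\infty\}$, where $M_j\subseteq M_{j+1}$, $f$ is bounded on each $M_j$ and $E(\cup_jM_j)=I$. The spectral measure $E$ of the normal operator $T$ is the spectral measure on $\mathscr B(\sigma_S(T)\cap\mathbb C_{\mathfrak I}^+)$, with an associated imaginary operator $J$, such that $T=\mathbb I(\lambda\mapsto\lambda)=\int\mathrm{Re}(\lambda)\,dE(\lambda)+\int\mathrm{Im}(\lambda)\,dE(\lambda)\,J$; $\mathbb I(f)$ in the claim is formed with this $E$ and $J$. *)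

theory Defs
  imports "HOL-Analysis.Analysis"
begin

section \<open>The Clifford algebra and Clifford modules\<close>

text \<open>
  The generators \<open>e\<^sub>1, \<dots>, e\<^sub>n\<close> are indexed by a finite linearly ordered type \<^typ>\<open>'n\<close> with
  \<open>n = CARD('n) \<ge> 1\<close> elements, and the basis elements \<open>e\<^sub>\<alpha>\<close> by \<open>\<alpha> :: 'n set\<close>. An element
  \<open>\<Sum>\<^sub>\<alpha> x\<^sub>\<alpha> e\<^sub>\<alpha>\<close> is the vector of its coefficients \<open>x $ \<alpha>\<close>, so that the library norm of
  \<^type>\<open>vec\<close> is the norm \<open>(\<Sum>\<^sub>\<alpha> \<parallel>x\<^sub>\<alpha>\<parallel>\<^sup>2)\<^sup>1\<^sup>/\<^sup>2\<close>. The componentwise multiplication and the constant-one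
  vector that \<^type>\<open>vec\<close> also carries are never used; the product is \<open>rmul\<close>, the unit is \<open>blade {}\<close>.
\<close>

type_synonym ('h, 'n) cmodule = "('h, 'n set) vec"
type_synonym 'n clifford = "(real, 'n) cmodule"

definition blade :: "'n::finite set \<Rightarrow> 'n clifford"
  where "blade \<alpha> = axis \<alpha> 1"

text \<open>
  The sign in \<open>e\<^sub>\<alpha> e\<^sub>\<beta> = \<plusminus> e\<^sub>\<gamma>\<close>, where \<open>\<gamma>\<close> is the symmetric difference of \<open>\<alpha>\<close> and \<open>\<beta>\<close>: sorting the
  generators costs one factor \<open>-1\<close> for each pair \<open>i \<in> \<alpha>, j \<in> \<beta>\<close> with \<open>j < i\<close> (anticommutation), and one
  for each pair with \<open>j = i\<close> (as \<open>e\<^sub>i\<^sup>2 = -1\<close>).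
\<close>

definition blade_sign :: "'n::{finite,linorder} set \<Rightarrow> 'n set \<Rightarrow> real"
  where "blade_sign \<alpha> \<beta> = (\<Prod>i\<in>\<alpha>. \<Prod>j\<in>\<beta>. if j \<le> i then - 1 else 1)"

text \<open>
  The right action of the Clifford algebra on the module; for real coefficients
  this is the multiplication of the algebra itself.
\<close>

definition rmul :: "('h::real_vector, 'n::{finite,linorder}) cmodule \<Rightarrow> 'n clifford \<Rightarrow> ('h, 'n) cmodule"
    (infixl "\<odot>" 75)
  where "x \<odot> a = (\<Sum>\<alpha>\<in>UNIV. \<Sum>\<beta>\<in>UNIV. axis (sym_diff \<alpha> \<beta>) ((blade_sign \<alpha> \<beta> * a $ \<beta>) *\<^sub>R x $ \<alpha>))"

text \<open>
  The sign relating \<open>e\<^sub>\<alpha>\<close> to its conjugate is that of \<open>e\<^sub>\<alpha> e\<^sub>\<alpha>\<close>, because the conjugate of \<open>e\<^sub>\<alpha>\<close>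
  is its inverse. The lemmas \<open>cconj_rmul\<close>, \<open>cconj_one\<close> and \<open>cconj_generator\<close> below determine
  this real-linear map uniquely.
\<close>

definition cconj :: "'n::{finite,linorder} clifford \<Rightarrow> 'n clifford"
  where "cconj a = (\<chi> \<alpha>. blade_sign \<alpha> \<alpha> * a $ \<alpha>)"

definition cRe :: "'n::finite clifford \<Rightarrow> real"
  where "cRe a = a $ {}"

definition cinner ::
    "('h::real_inner, 'n::{finite,linorder}) cmodule \<Rightarrow> ('h, 'n) cmodule \<Rightarrow> 'n clifford"
  where "cinner x y = (\<Sum>\<alpha>\<in>UNIV. \<Sum>\<beta>\<in>UNIV. inner (x $ \<alpha>) (y $ \<beta>) *\<^sub>R (cconj (blade \<beta>) \<odot> blade \<alpha>))"


lemma prod_sym_diff_pm1: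
  fixes f :: "'a \<Rightarrow> real"
  assumes "finite A" "finite B" and "\<And>i. f i * f i = 1"
  shows "prod f (sym_diff A B) = prod f A * prod f B"
proof -
  have sq: "prod f (A \<inter> B) * prod f (A \<inter> B) = 1"
    using assms(3) by (simp flip: prod.distrib)
  have A: "prod f A = prod f (A - B) * prod f (A \<inter> B)"
    using assms(1) by (metis Int_Diff_disjoint Un_Diff_Int finite_Diff finite_Int inf_commute
        prod.union_disjoint)
  have B: "prod f B = prod f (B - A) * prod f (A \<inter> B)"
    using assms(2) by (metis Int_Diff_disjoint Un_Diff_Int finite_Diff finite_Int inf_commute
        prod.union_disjoint)
  have "prod f (sym_diff A B) = prod f (A - B) * prod f (B - A)"
    using assms by (intro prod.union_disjoint) auto
  also have "\<dots> = prod f (A - B) * prod f (B - A) * (prod f (A \<inter> B) * prod f (A \<inter> B))"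
    by (simp only: sq mult_1_right)
  finally show ?thesis
    by (simp only: A B mult_ac)
qed

lemma blade_sign_square: "blade_sign \<alpha> \<beta> * blade_sign \<alpha> \<beta> = 1"
  by (auto simp: blade_sign_def simp flip: prod.distrib intro!: prod.neutral)

lemma blade_sign_sym_diff_right:
  "blade_sign \<alpha> (sym_diff \<beta> \<gamma>) = blade_sign \<alpha> \<beta> * blade_sign \<alpha> \<gamma>"
proof -
  have "(\<Prod>j\<in>sym_diff \<beta> \<gamma>. if j \<le> i then - 1 else 1 :: real) =
     (\<Prod>j\<in>\<beta>. if j \<le> i then - 1 else 1) * (\<Prod>j\<in>\<gamma>. if j \<le> i then - 1 else 1)" for i :: 'a
    by (rule prod_sym_diff_pm1) auto
  then show ?thesis
    by (simp add: blade_sign_def prod.distrib)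
qed

lemma blade_sign_sym_diff_left:
  "blade_sign (sym_diff \<alpha> \<beta>) \<gamma> = blade_sign \<alpha> \<gamma> * blade_sign \<beta> \<gamma>"
  unfolding blade_sign_def
  by (rule prod_sym_diff_pm1) (auto simp flip: prod.distrib intro!: prod.neutral)

lemma blade_sign_empty [simp]: "blade_sign {} \<beta> = 1" "blade_sign \<alpha> {} = 1"
  by (simp_all add: blade_sign_def)

lemma axis_expansion: "(x :: ('a::comm_monoid_add, 'i::finite) vec) = (\<Sum>i\<in>UNIV. axis i (x $ i))"
  by (simp add: vec_eq_iff axis_def)

lemma rmul_axis:
  "axis \<alpha> x \<odot> axis \<beta> r = axis (sym_diff \<alpha> \<beta>) ((blade_sign \<alpha> \<beta> * r) *\<^sub>R x)"
proof -
  have "axis \<alpha> x \<odot> axis \<beta> r = (\<Sum>\<alpha>'\<in>UNIV. \<Sum>\<beta>'\<in>UNIV.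
      if \<beta>' = \<beta> then if \<alpha>' = \<alpha> then axis (sym_diff \<alpha> \<beta>) ((blade_sign \<alpha> \<beta> * r) *\<^sub>R x) else 0 else 0)"
    unfolding rmul_def by (intro sum.cong refl) (auto simp: axis_def vec_eq_iff)
  then show ?thesis
    by simp
qed

lemma rmul_add_left: "(x + y) \<odot> a = x \<odot> a + y \<odot> a"
  by (simp add: rmul_def vec_eq_iff axis_def scaleR_add_right flip: sum.distrib cong: if_cong)
    (auto intro!: sum.cong simp: algebra_simps)

lemma rmul_add_right: "x \<odot> (a + b) = x \<odot> a + x \<odot> b"
  by (simp add: rmul_def vec_eq_iff axis_def flip: sum.distrib cong: if_cong)
    (auto intro!: sum.cong simp: algebra_simps)

lemma rmul_zero_left [simp]: "0 \<odot> a = 0"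
  by (metis add_cancel_right_right rmul_add_left)

lemma rmul_zero_right [simp]: "x \<odot> 0 = 0"
  by (metis add_cancel_right_right rmul_add_right)

lemma rmul_sum_left: "(\<Sum>i\<in>A. f i) \<odot> a = (\<Sum>i\<in>A. f i \<odot> a)"
  by (induction A rule: infinite_finite_induct) (simp_all add: rmul_add_left)

lemma rmul_sum_right: "x \<odot> (\<Sum>i\<in>A. f i) = (\<Sum>i\<in>A. x \<odot> f i)"
  by (induction A rule: infinite_finite_induct) (simp_all add: rmul_add_right)

lemma sym_diff_assoc: "sym_diff (sym_diff A B) C = sym_diff A (sym_diff B C)"
  by blast

lemma rmul_assoc:
  fixes x :: "('a::real_vector, 'b::{finite,linorder}) cmodule"
  shows "(x \<odot> a) \<odot> b = x \<odot> (a \<odot> b)"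
proof -
  have *: "(axis \<alpha> u \<odot> axis \<beta> r) \<odot> axis \<gamma> s = axis \<alpha> u \<odot> (axis \<beta> r \<odot> axis \<gamma> s)"
    for \<alpha> \<beta> \<gamma> :: "'b set" and u :: 'a and r s :: real
    unfolding rmul_axis sym_diff_assoc blade_sign_sym_diff_left blade_sign_sym_diff_right
    by (simp add: mult_ac)
  have **: "(axis \<alpha> u \<odot> axis \<beta> r) \<odot> b = axis \<alpha> u \<odot> (axis \<beta> r \<odot> b)"
    for \<alpha> \<beta> :: "'b set" and u :: 'a and r :: real
  proof -
    have "(axis \<alpha> u \<odot> axis \<beta> r) \<odot> (\<Sum>k\<in>UNIV. axis k (b $ k)) =
        axis \<alpha> u \<odot> (axis \<beta> r \<odot> (\<Sum>k\<in>UNIV. axis k (b $ k)))"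
      by (simp only: rmul_sum_right *)
    then show ?thesis
      by (simp flip: axis_expansion)
  qed
  have ***: "(axis \<alpha> u \<odot> a) \<odot> b = axis \<alpha> u \<odot> (a \<odot> b)" for \<alpha> :: "'b set" and u :: 'a
  proof -
    have "(axis \<alpha> u \<odot> (\<Sum>k\<in>UNIV. axis k (a $ k))) \<odot> b =
        axis \<alpha> u \<odot> ((\<Sum>k\<in>UNIV. axis k (a $ k)) \<odot> b)"
      by (simp only: rmul_sum_left rmul_sum_right **)
    then show ?thesis
      by (simp flip: axis_expansion)
  qed
  have "((\<Sum>k\<in>UNIV. axis k (x $ k)) \<odot> a) \<odot> b = (\<Sum>k\<in>UNIV. axis k (x $ k)) \<odot> (a \<odot> b)"
    by (simp only: rmul_sum_left ***)
  then show ?thesis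
    by (simp flip: axis_expansion)
qed

lemma rmul_one: "x \<odot> blade {} = x"
proof -
  have "(\<Sum>i\<in>UNIV. axis i (x $ i)) \<odot> blade {} = (\<Sum>i\<in>UNIV. axis i (x $ i))"
    by (simp add: rmul_sum_left blade_def rmul_axis)
  then show ?thesis
    by (simp flip: axis_expansion)
qed

lemma one_rmul: "blade {} \<odot> a = a"
proof -
  have "blade {} \<odot> (\<Sum>i\<in>UNIV. axis i (a $ i)) = (\<Sum>i\<in>UNIV. axis i (a $ i))"
    by (simp add: rmul_sum_right blade_def rmul_axis)
  then show ?thesis
    by (simp flip: axis_expansion)
qed

lemma axis_uminus: "axis k (- x) = - axis k (x :: 'a::ab_group_add)"
  by (simp add: axis_def vec_eq_iff)

lemma generator_square: "blade {i} \<odot> blade {i} = - blade {}"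
  by (simp add: blade_def rmul_axis blade_sign_def axis_uminus)

lemma generator_anticommute: "i \<noteq> j \<Longrightarrow> blade {i} \<odot> blade {j} = - (blade {j} \<odot> blade {i})"
  by (auto simp: blade_def rmul_axis blade_sign_def axis_uminus insert_commute Un_commute)

lemma blade_insert: "(\<And>j. j \<in> \<alpha> \<Longrightarrow> i < j) \<Longrightarrow> blade (insert i \<alpha>) = blade {i} \<odot> blade \<alpha>"
proof -
  assume less: "\<And>j. j \<in> \<alpha> \<Longrightarrow> i < j"
  then have "i \<notin> \<alpha>"
    by blast
  then have "sym_diff {i} \<alpha> = insert i \<alpha>"
    by auto
  moreover have "blade_sign {i} \<alpha> = 1"
    using less by (simp add: blade_sign_def prod.neutral not_le)
  ultimately show ?thesis
    by (simp add: blade_def rmul_axis)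
qed

lemma cconj_axis: "cconj (axis \<alpha> r) = axis \<alpha> (blade_sign \<alpha> \<alpha> * r)"
  by (simp add: cconj_def axis_def vec_eq_iff)

lemma cconj_sum: "cconj (\<Sum>i\<in>A. f i) = (\<Sum>i\<in>A. cconj (f i))"
  by (simp add: cconj_def vec_eq_iff sum_distrib_left)

lemma cconj_rmul:
  fixes a b :: "'a::{finite,linorder} clifford"
  shows "cconj (a \<odot> b) = cconj b \<odot> cconj a"
proof -
  have *: "cconj (axis \<alpha> r \<odot> axis \<beta> s) = cconj (axis \<beta> s) \<odot> cconj (axis \<alpha> r)"
    for \<alpha> \<beta> :: "'a set" and r s :: real
  proof -
    have cancel: "blade_sign \<alpha> \<beta> * (blade_sign \<alpha> \<beta> * c) = c" for c
      using blade_sign_square[of \<alpha> \<beta>] by (metis mult.assoc mult_1_left)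
    show ?thesis
      unfolding cconj_axis rmul_axis blade_sign_sym_diff_left blade_sign_sym_diff_right
      by (simp add: Un_commute mult_ac cancel)
  qed
  have "cconj ((\<Sum>i\<in>UNIV. axis i (a $ i)) \<odot> (\<Sum>j\<in>UNIV. axis j (b $ j))) =
      cconj (\<Sum>j\<in>UNIV. axis j (b $ j)) \<odot> cconj (\<Sum>i\<in>UNIV. axis i (a $ i))"
    unfolding cconj_sum rmul_sum_left rmul_sum_right * by (rule sum.swap)
  then show ?thesis
    by (simp flip: axis_expansion)
qed

lemma cconj_one: "cconj (blade {}) = blade {}"
  by (simp add: blade_def cconj_axis)

lemma cconj_generator: "cconj (blade {i}) = - blade {i}"
  by (simp add: blade_def cconj_axis blade_sign_def axis_uminus)

lemma cRe_cinner:
  fixes x y :: "('h::real_inner, 'n::{finite,linorder}) cmodule"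
  shows "cRe (cinner x y) = inner x y"
proof -
  have "cconj (blade \<beta>) \<odot> blade \<alpha> = axis (sym_diff \<beta> \<alpha>) (blade_sign \<beta> \<alpha> * blade_sign \<beta> \<beta>)"
    for \<alpha> \<beta> :: "'n set"
    by (simp add: blade_def cconj_axis rmul_axis)
  then have "(inner (x $ \<alpha>) (y $ \<beta>) *\<^sub>R (cconj (blade \<beta>) \<odot> blade \<alpha>)) $ {} =
      (if \<beta> = \<alpha> then inner (x $ \<alpha>) (y $ \<alpha>) else 0)" for \<alpha> \<beta>
    by (cases "\<beta> = \<alpha>") (auto simp: axis_def blade_sign_square)
  then have "cRe (cinner x y) = (\<Sum>\<alpha>\<in>UNIV. \<Sum>\<beta>\<in>UNIV. if \<beta> = \<alpha> then inner (x $ \<alpha>) (y $ \<alpha>) else 0)"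
    by (simp add: cinner_def cRe_def)
  then show ?thesis
    by (simp add: inner_vec_def)
qed


section \<open>Paravectors\<close>

definition paravectors :: "'n::finite clifford set"
  where "paravectors = {s. \<exists>s0 c. s = s0 *\<^sub>R blade {} + (\<Sum>j\<in>UNIV. c j *\<^sub>R blade {j})}"

definition imag_sphere :: "'n::finite clifford set"
  where "imag_sphere = {s. \<exists>c. s = (\<Sum>j\<in>UNIV. c j *\<^sub>R blade {j}) \<and> (\<Sum>j\<in>UNIV. (c j)\<^sup>2) = 1}"

text \<open>
  The paravector \<open>u + v \<II>\<close>, for an imaginary unit \<open>\<II> \<in> imag_sphere\<close>.
\<close>

definition ipoint :: "'n::finite clifford \<Rightarrow> real \<Rightarrow> real \<Rightarrow> 'n clifford"
  where "ipoint \<II> u v = u *\<^sub>R blade {} + v *\<^sub>R \<II>"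

definition islice :: "'n::finite clifford \<Rightarrow> 'n clifford set"
  where "islice \<II> = {ipoint \<II> u v | u v. True}"

definition ihalf :: "'n::finite clifford \<Rightarrow> 'n clifford set"
  where "ihalf \<II> = {ipoint \<II> u v | u v. v \<ge> 0}"

text \<open>
  \<open>iIm \<II> c\<close> is the real number \<open>v\<close> in \<open>c = u + v \<II>\<close>: see \<open>iIm_ipoint\<close>.
\<close>

definition iIm :: "'n::finite clifford \<Rightarrow> 'n clifford \<Rightarrow> real"
  where "iIm \<II> c = inner c \<II>"

lemma generator_sum_nth:
  "(\<Sum>j\<in>UNIV. c j *\<^sub>R blade {j :: 'n::finite}) $ \<alpha> = (\<Sum>j\<in>UNIV. if \<alpha> = {j} then c j else 0)"
  by (auto simp: blade_def axis_def intro!: sum.cong)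

lemma imag_sphere_inner:
  assumes "\<II> \<in> imag_sphere"
  shows "inner \<II> \<II> = 1" "inner (blade {}) \<II> = 0" "\<II> $ {} = 0"
proof -
  obtain c where I: "\<II> = (\<Sum>j\<in>UNIV. c j *\<^sub>R blade {j})" and c: "(\<Sum>j\<in>UNIV. (c j)\<^sup>2) = 1"
    using assms unfolding imag_sphere_def by blast
  have gen: "inner (blade {i}) (blade {j}) = (if i = j then 1 else 0)" for i j :: 'a
    by (simp add: blade_def inner_axis_axis)
  have one: "inner (blade {}) (blade {j}) = 0" for j :: 'a
    by (simp add: blade_def inner_axis_axis)
  show "inner \<II> \<II> = 1"
    unfolding I using c
    by (simp add: inner_sum_left inner_sum_right gen power2_eq_square if_distrib cong: if_cong)
  show "inner (blade {}) \<II> = 0"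
    unfolding I by (simp add: inner_sum_right one)
  show "\<II> $ {} = 0"
    unfolding I generator_sum_nth by simp
qed

lemma iIm_ipoint: "\<II> \<in> imag_sphere \<Longrightarrow> iIm \<II> (ipoint \<II> u v) = v"
  by (simp add: iIm_def ipoint_def inner_add_left imag_sphere_inner)

lemma cRe_ipoint: "\<II> \<in> imag_sphere \<Longrightarrow> cRe (ipoint \<II> u v) = u"
  by (simp add: cRe_def ipoint_def imag_sphere_inner blade_def axis_def)

lemma norm_ipoint:
  fixes \<II> :: "'n::finite clifford"
  assumes I: "\<II> \<in> imag_sphere"
  shows "norm (ipoint \<II> u v) = sqrt (u\<^sup>2 + v\<^sup>2)"
proof -
  have "inner (blade {}) (blade {} :: 'n clifford) = 1"
    by (simp add: blade_def inner_axis_axis)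
  then have "inner (ipoint \<II> u v) (ipoint \<II> u v) = u\<^sup>2 + v\<^sup>2"
    using imag_sphere_inner[OF I]
    by (simp add: ipoint_def inner_add_left inner_add_right inner_commute power2_eq_square)
  then show ?thesis
    by (simp add: norm_eq_sqrt_inner)
qed

lemma ipoint_paravector:
  assumes "\<II> \<in> imag_sphere"
  shows "ipoint \<II> u v \<in> paravectors"
proof -
  obtain c where "\<II> = (\<Sum>j\<in>UNIV. c j *\<^sub>R blade {j})"
    using assms unfolding imag_sphere_def by blast
  then have "ipoint \<II> u v = u *\<^sub>R blade {} + (\<Sum>j\<in>UNIV. (v * c j) *\<^sub>R blade {j})"
    by (simp add: ipoint_def scaleR_sum_right)
  then show ?thesis
    unfolding paravectors_def mem_Collect_eq by (intro exI[of _ u] exI[of _ "\<lambda>j. v * c j"])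
qed

definition axially_symmetric :: "'n::finite clifford set \<Rightarrow> bool"
  where "axially_symmetric \<Omega> \<longleftrightarrow> (\<forall>u v. \<forall>\<II>\<in>imag_sphere. ipoint \<II> u v \<in> \<Omega> \<longrightarrow>
           (\<forall>\<JJ>\<in>imag_sphere. ipoint \<JJ> u v \<in> \<Omega>))"

definition intrinsic_on :: "'n::finite clifford set \<Rightarrow> ('n clifford \<Rightarrow> 'n clifford) \<Rightarrow> bool"
  where "intrinsic_on \<Omega> f \<longleftrightarrow> axially_symmetric \<Omega> \<and>
           (\<exists>f0 f1 :: real \<Rightarrow> real \<Rightarrow> real. \<forall>u v. \<forall>\<II>\<in>imag_sphere. ipoint \<II> u v \<in> \<Omega> \<longrightarrow>
              f (ipoint \<II> u v) = ipoint \<II> (f0 u v) (f1 u v) \<and>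
              f0 u (- v) = f0 u v \<and> f1 u (- v) = - f1 u v)"


section \<open>Right linear operators\<close>

text \<open>
  An operator is a partial map \<open>T\<close> with domain \<open>dom T\<close>; thus \<open>S \<circ>\<^sub>m T\<close> is the composition on its
  natural domain, \<open>Some\<close> is the identity operator, and equality of operators includes
  equality of the domains. Everywhere defined bounded operators also occur as elements of the
  library type of bounded linear maps, which carries the operator norm; \<open>total_op\<close> is the inclusion.
\<close>

type_synonym ('h, 'n) op = "('h, 'n) cmodule \<rightharpoonup> ('h, 'n) cmodule"
type_synonym ('h, 'n) bop = "('h, 'n) cmodule \<Rightarrow>\<^sub>L ('h, 'n) cmodule"

definition right_linear_op :: "('h::real_inner, 'n::{finite,linorder}) op \<Rightarrow> bool"
  where "right_linear_op T \<longleftrightarrow>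
           0 \<in> dom T \<and>
           (\<forall>x\<in>dom T. \<forall>y\<in>dom T. x + y \<in> dom T \<and> the (T (x + y)) = the (T x) + the (T y)) \<and>
           (\<forall>x\<in>dom T. \<forall>a. x \<odot> a \<in> dom T \<and> the (T (x \<odot> a)) = the (T x) \<odot> a)"

definition bounded_op :: "('h::real_inner, 'n::finite) op \<Rightarrow> bool"
  where "bounded_op T \<longleftrightarrow> (\<exists>C. \<forall>x\<in>dom T. norm (the (T x)) \<le> C * norm x)"

definition total_op :: "('h::real_inner, 'n::finite) bop \<Rightarrow> ('h, 'n) op"
  where "total_op A = (\<lambda>x. Some (blinfun_apply A x))"

definition adjoint_op :: "('h::real_inner, 'n::{finite,linorder}) op \<Rightarrow> ('h, 'n) op"
  where "adjoint_op T = (\<lambda>y.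
           if \<exists>z. \<forall>x\<in>dom T. cinner (the (T x)) y = cinner x z
           then Some (THE z. \<forall>x\<in>dom T. cinner (the (T x)) y = cinner x z)
           else None)"

definition inverse_op :: "('h::real_inner, 'n::finite) op \<Rightarrow> ('h, 'n) op"
  where "inverse_op T = (\<lambda>y. if y \<in> ran T then Some (THE x. T x = Some y) else None)"

definition normal_op :: "('h::real_inner, 'n::{finite,linorder}) op \<Rightarrow> bool"
  where "normal_op T \<longleftrightarrow> right_linear_op T \<and>
           closure (dom T) = UNIV \<and>
           closed (Map.graph T) \<and>
           dom T = dom (adjoint_op T) \<and>
           T \<circ>\<^sub>m adjoint_op T = adjoint_op T \<circ>\<^sub>m T"

definition bounded_ops :: "('h::real_inner, 'n::{finite,linorder}) op set"
  where "bounded_ops = {T. right_linear_op T \<and> dom T = UNIV \<and> bounded_op T}"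

definition orthogonal_projection :: "('h::real_inner, 'n::{finite,linorder}) bop \<Rightarrow> bool"
  where "orthogonal_projection P \<longleftrightarrow> total_op P \<in> bounded_ops \<and>
           adjoint_op (total_op P) = total_op P \<and> P o\<^sub>L P = P"

definition unitary_op :: "('h::real_inner, 'n::{finite,linorder}) bop \<Rightarrow> bool"
  where "unitary_op U \<longleftrightarrow> total_op U \<in> bounded_ops \<and>
           total_op U \<circ>\<^sub>m adjoint_op (total_op U) = Some \<and>
           adjoint_op (total_op U) \<circ>\<^sub>m total_op U = Some"

definition imaginary_operator :: "('h::real_inner, 'n::{finite,linorder}) bop \<Rightarrow> bool"
  where "imaginary_operator J \<longleftrightarrow> unitary_op J \<and> adjoint_op (total_op J) = total_op (- J)"


section \<open>The S-spectrum\<close>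

definition Q_op :: "'n clifford \<Rightarrow> ('h::real_inner, 'n::finite) op \<Rightarrow> ('h, 'n) op"
  where "Q_op s T = (\<lambda>x. map_option
           (\<lambda>z. z - (2 * cRe s) *\<^sub>R the (T x) + (norm s)\<^sup>2 *\<^sub>R x) ((T \<circ>\<^sub>m T) x))"

definition S_resolvent_set :: "('h::real_inner, 'n::finite) op \<Rightarrow> 'n clifford set"
  where "S_resolvent_set T = {s \<in> paravectors.
           (\<forall>x. Q_op s T x = Some 0 \<longrightarrow> x = 0) \<and>
           closure (ran (Q_op s T)) = UNIV \<and>
           bounded_op (inverse_op (Q_op s T))}"

definition S_spectrum :: "('h::real_inner, 'n::finite) op \<Rightarrow> 'n clifford set"
  where "S_spectrum T = paravectors - S_resolvent_set T"

lemma axially_symmetric_S_spectrum: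
  fixes T :: "('h::real_inner, 'a::finite) op"
  shows "axially_symmetric (S_spectrum T)"
proof -
  have Q: "Q_op (ipoint \<II> u v) T = Q_op (ipoint \<JJ> u v) T"
    if "\<II> \<in> imag_sphere" "\<JJ> \<in> imag_sphere" for \<II> \<JJ> u v
    using that by (simp add: Q_op_def cRe_ipoint norm_ipoint)
  show ?thesis
    unfolding axially_symmetric_def
  proof (intro allI ballI impI)
    fix u v and \<II> \<JJ> :: "'a clifford"
    assume "\<II> \<in> imag_sphere" "\<JJ> \<in> imag_sphere" "ipoint \<II> u v \<in> S_spectrum T"
    then show "ipoint \<JJ> u v \<in> S_spectrum T"
      by (simp add: S_spectrum_def S_resolvent_set_def ipoint_paravector Q[of \<II> \<JJ>])
  qed
qed


section \<open>Spectral measures and the functional calculus\<close>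

text \<open>
  The \<open>\<sigma>\<close>-algebra on which a spectral measure lives is that of the measure space \<open>M\<close>; its
  scalar measure is irrelevant.
\<close>

definition spectral_measure ::
    "'n clifford measure \<Rightarrow> ('n clifford set \<Rightarrow> ('h::real_inner, 'n::{finite,linorder}) bop) \<Rightarrow> bool"
  where "spectral_measure M E \<longleftrightarrow>
           (\<forall>A\<in>sets M. orthogonal_projection (E A)) \<and>
           (\<forall>A :: nat \<Rightarrow> 'n clifford set. range A \<subseteq> sets M \<longrightarrow> disjoint_family A \<longrightarrow>
              (\<forall>x. (\<lambda>i. blinfun_apply (E (A i)) x) sums blinfun_apply (E (\<Union>i. A i)) x)) \<and>
           E (space M) = id_blinfun"

definition associated_with ::
    "('h::real_inner, 'n::{finite,linorder}) bop \<Rightarrow> 'n clifford measure \<Rightarrow>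
     ('n clifford set \<Rightarrow> ('h, 'n) bop) \<Rightarrow> bool"
  where "associated_with J M E \<longleftrightarrow> (\<forall>A\<in>sets M. J o\<^sub>L E A = E A o\<^sub>L J)"

definition scalar_measure ::
    "'n clifford measure \<Rightarrow> ('n clifford set \<Rightarrow> ('h::real_inner, 'n::{finite,linorder}) bop) \<Rightarrow>
     ('h, 'n) cmodule \<Rightarrow> 'n clifford measure"
  where "scalar_measure M E x =
           measure_of (space M) (sets M) (\<lambda>A. ennreal (cRe (cinner (blinfun_apply (E A) x) x)))"

definition simple_integral_op ::
    "'n clifford \<Rightarrow> 'n clifford measure \<Rightarrow> ('n clifford set \<Rightarrow> ('h, 'n) bop) \<Rightarrow> ('h, 'n) bop \<Rightarrow>
     ('n clifford \<Rightarrow> 'n clifford) \<Rightarrow> ('h::{real_inner,banach}, 'n::{finite,linorder}) bop"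
  where "simple_integral_op \<II> M E J f = (\<Sum>c\<in>f ` space M.
           cRe c *\<^sub>R E (f -` {c} \<inter> space M) + iIm \<II> c *\<^sub>R (E (f -` {c} \<inter> space M) o\<^sub>L J))"

text \<open>
  The limit below is taken with respect to the operator norm.
\<close>

definition bounded_integral_op ::
    "'n clifford \<Rightarrow> 'n clifford measure \<Rightarrow> ('n clifford set \<Rightarrow> ('h, 'n) bop) \<Rightarrow> ('h, 'n) bop \<Rightarrow>
     ('n clifford \<Rightarrow> 'n clifford) \<Rightarrow> ('h::{real_inner,banach}, 'n::{finite,linorder}) bop"
  where "bounded_integral_op \<II> M E J f = (THE A. \<exists>F :: nat \<Rightarrow> 'n clifford \<Rightarrow> 'n clifford.
           (\<forall>j. simple_function M (F j) \<and> F j ` space M \<subseteq> islice \<II>) \<and>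
           uniform_limit (space M) F f sequentially \<and>
           (\<lambda>j. simple_integral_op \<II> M E J (F j)) \<longlonglongrightarrow> A)"

definition spectral_integral ::
    "'n clifford \<Rightarrow> 'n clifford measure \<Rightarrow> ('n clifford set \<Rightarrow> ('h, 'n) bop) \<Rightarrow> ('h, 'n) bop \<Rightarrow>
     ('n clifford \<Rightarrow> 'n clifford) \<Rightarrow> ('h::{real_inner,banach}, 'n::{finite,linorder}) op"
  where "spectral_integral \<II> M E J f =
           (if bounded (f ` space M) then total_op (bounded_integral_op \<II> M E J f)
            else (\<lambda>x.
              if (\<integral>\<^sup>+\<omega>. ennreal ((norm (f \<omega>))\<^sup>2) \<partial>scalar_measure M E x) < \<infinity>
              then Some (THE y. \<exists>S :: nat \<Rightarrow> 'n clifford set.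
                (\<forall>j. S j \<in> sets M \<and> S j \<subseteq> S (Suc j) \<and> bounded (f ` S j)) \<and>
                E (\<Union>j. S j) = id_blinfun \<and>
                (\<lambda>j. blinfun_apply
                   (bounded_integral_op \<II> M E J (\<lambda>\<omega>. indicator (S j) \<omega> *\<^sub>R f \<omega>)) x) \<longlonglongrightarrow> y)
              else None))"

definition spectral_space :: "'n clifford \<Rightarrow> ('h::real_inner, 'n::finite) op \<Rightarrow> 'n clifford measure"
  where "spectral_space \<II> T = restrict_space borel (S_spectrum T \<inter> ihalf \<II>)"

definition spectral_measure_of ::
    "'n clifford \<Rightarrow> ('h::{real_inner,banach}, 'n::{finite,linorder}) op \<Rightarrow>
     ('n clifford set \<Rightarrow> ('h, 'n) bop) \<Rightarrow> ('h, 'n) bop \<Rightarrow> bool"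
  where "spectral_measure_of \<II> T E J \<longleftrightarrow>
           spectral_measure (spectral_space \<II> T) E \<and>
           imaginary_operator J \<and>
           associated_with J (spectral_space \<II> T) E \<and>
           T = spectral_integral \<II> (spectral_space \<II> T) E J (\<lambda>\<omega>. \<omega>)"

end

theory Submission
  imports Defs
begin

text \<open>
  Since \<open>J\<^sup>2 = - I\<close> and \<open>J\<close> is skew, \<open>a + b i \<mapsto> a I + b J\<close> turns the module into a complex Hilbert space in
  which all \<open>E A\<close> are complex-linear projections, so functions with values in \<open>\<complex>\<^sub>\<II>\<close> may be treated as
  complex functions, and \<open>\<I>\<close> is a multiplicative calculus on the bounded ones. On \<open>\<complex>\<^sub>\<II>\<close> the symbol of
  \<open>\<Q>\<^sub>c(\<I>(g))\<close> is \<open>(g - c) (g - cnj c)\<close>. Dividing by it where it is bounded away from zero shows that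
  \<open>c\<close> is in the S-spectrum of \<open>\<I>(g)\<close> iff \<open>c\<close> or \<open>cnj c\<close> is in the \<open>E\<close>-essential range of \<open>g\<close>; this
  includes unbounded \<open>g\<close>. For \<open>g = id\<close> this says that nonempty relatively open subsets of
  \<open>\<sigma>\<^sub>S(T) \<inter> \<complex>\<^sub>\<II>\<^sup>+\<close> are not \<open>E\<close>-null. Hence the essential range of a continuous \<open>f\<close> is the closure of its
  range, and the conjugates are accounted for because \<open>f\<close> is intrinsic. If \<open>T\<close> is bounded, the
  spectrum in \<open>\<complex>\<^sub>\<II>\<close> is compact.
\<close>

section \<open>Functional calculus of a projection-valued measure\<close>

text \<open>The Clifford data is reduced to a real Hilbert space whose inner product is the real
  part of the Clifford-valued one. \<open>J_skew\<close> and \<open>J_J\<close> together encode that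
  \<open>J\<close> is unitary with adjoint \<open>- J\<close>.\<close>

locale spectral_calculus =
  fixes M :: "'w measure"
    and E :: "'w set \<Rightarrow> 'a::{real_inner,banach} \<Rightarrow>\<^sub>L 'a"
    and J :: "'a \<Rightarrow>\<^sub>L 'a"
  assumes E_sym: "A \<in> sets M \<Longrightarrow> inner (E A x) y = inner x (E A y)"
    and E_idem: "A \<in> sets M \<Longrightarrow> E A (E A x) = E A x"
    and E_sums: "range B \<subseteq> sets M \<Longrightarrow> disjoint_family B \<Longrightarrow> (\<lambda>i. E (B i) x) sums E (\<Union>i. B i) x"
    and E_space: "E (space M) x = x"
    and J_skew: "inner (J x) y = - inner x (J y)"
    and J_J: "J (J x) = - x"
    and E_J: "A \<in> sets M \<Longrightarrow> E A (J x) = J (E A x)"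
begin

section \<open>Additivity and multiplicativity of the projections \<open>E A\<close>\<close>

lemma E_empty [simp]: "E {} = 0"
proof (rule blinfun_eqI)
  fix x
  \<comment> \<open>The constant sequence \<open>{}\<close> is disjoint, so the series with constant
    term \<open>E {} x\<close> converges, and its terms must tend to zero.\<close>
  have "(\<lambda>i::nat. E {} x) sums E (\<Union>i::nat. {}) x"
    by (rule E_sums) (auto simp: disjoint_family_on_def)
  then have "(\<lambda>i::nat. E {} x) \<longlonglongrightarrow> 0"
    using sums_summable summable_LIMSEQ_zero by blast
  then show "E {} x = blinfun_apply 0 x"
    by (simp add: LIMSEQ_const_iff)
qed

lemma E_Un:
  assumes "A \<in> sets M" "B \<in> sets M" "A \<inter> B = {}"
  shows "E (A \<union> B) = E A + E B"
proof (rule blinfun_eqI)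
  fix x
  have "(\<lambda>i. E (binaryset A B i) x) sums E (\<Union>i. binaryset A B i) x"
    using assms
    by (intro E_sums) (auto simp: range_binaryset_eq disjoint_family_on_def binaryset_def)
  moreover have "(\<lambda>i. E (binaryset A B i) x) sums (E A x + E B x)"
    by (rule binaryset_sums) simp
  ultimately show "E (A \<union> B) x = (E A + E B) x"
    by (simp add: UN_binaryset_eq blinfun.add_left sums_unique2)
qed

lemma E_UN:
  assumes "finite I" "\<And>i. i \<in> I \<Longrightarrow> B i \<in> sets M" "disjoint_family_on B I"
  shows "E (\<Union>i\<in>I. B i) = (\<Sum>i\<in>I. E (B i))"
  using assms
proof (induction I rule: finite_induct)
  case (insert i I)
  have "B i \<inter> (\<Union>i\<in>I. B i) = {}" "disjoint_family_on B I"
    using insert by (auto simp: disjoint_family_on_def)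
  then show ?case
    using insert by (simp add: E_Un sets.finite_UN)
qed simp

lemma inner_E: "A \<in> sets M \<Longrightarrow> inner (E A x) x = (norm (E A x))\<^sup>2"
  by (metis E_idem E_sym power2_norm_eq_inner)

lemma norm_E_le: "A \<in> sets M \<Longrightarrow> norm (E A x) \<le> norm x"
  by (metis inner_E norm_cauchy_schwarz mult_le_cancel_left_pos norm_ge_zero order_le_less
      power2_eq_square)

text \<open>Squared lengths of projections are additive over disjoint sets. For
  \<open>y = E B x\<close> this gives |E A y|^2 + |y|^2 = |E (A \<union> B) y|^2, and the right-hand
  side is at most |y|^2 because projections are contractions.\<close>

lemma E_disjoint:
  assumes "A \<in> sets M" "B \<in> sets M" "A \<inter> B = {}"
  shows "E A (E B x) = 0"
proof -
  define y where "y = E B x"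
  have "(norm (E (A \<union> B) y))\<^sup>2 = inner (E (A \<union> B) y) y"
    using assms by (simp add: inner_E)
  also have "\<dots> = (norm (E A y))\<^sup>2 + (norm (E B y))\<^sup>2"
    using assms by (simp add: E_Un blinfun.add_left inner_add_left inner_E)
  also have "E B y = y"
    using assms by (simp add: y_def E_idem)
  finally have "(norm (E A y))\<^sup>2 + (norm y)\<^sup>2 = (norm (E (A \<union> B) y))\<^sup>2" ..
  also have "\<dots> \<le> (norm y)\<^sup>2"
    using assms by (intro power_mono norm_E_le) auto
  finally show ?thesis
    by (simp add: y_def)
qed

text \<open>Split both sets along the intersection; the products of projections for disjoint pieces
  vanish by \<open>E_disjoint\<close>, which leaves the square of
  \<open>E (A \<inter> B)\<close>.\<close>

lemma E_Int:
  assumes "A \<in> sets M" "B \<in> sets M"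
  shows "E A (E B x) = E (A \<inter> B) x"
proof -
  have A: "E A = E (A \<inter> B) + E (A - B)"
    using E_Un[of "A \<inter> B" "A - B"] assms by (auto simp: Int_Diff_Un)
  have B: "E B = E (A \<inter> B) + E (B - A)"
    using E_Un[of "A \<inter> B" "B - A"] assms by (auto simp: Int_Diff_Un Int_commute[of A])
  have "E A (E B x) = E (A \<inter> B) (E B x) + E (A - B) (E B x)"
    by (simp add: A blinfun.add_left)
  also have "E (A - B) (E B x) = 0"
    using assms by (intro E_disjoint) auto
  also have "E (A \<inter> B) (E B x) = E (A \<inter> B) (E (A \<inter> B) x) + E (A \<inter> B) (E (B - A) x)"
    by (simp add: B blinfun.add_left blinfun.add_right)
  also have "E (A \<inter> B) (E (B - A) x) = 0"
    using assms by (intro E_disjoint) auto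
  finally show ?thesis
    using assms by (simp add: E_idem)
qed

lemma E_subset:
  assumes "A \<in> sets M" "B \<in> sets M" "A \<subseteq> B"
  shows "E B (E A x) = E A x" "E A (E B x) = E A x"
  using assms by (simp_all add: E_Int Int_absorb1 Int_absorb2)

lemma E_null_subset:
  assumes "A \<in> sets M" "B \<in> sets M" "A \<subseteq> B" "E B = 0"
  shows "E A = 0"
proof (rule blinfun_eqI)
  show "E A x = blinfun_apply 0 x" for x
    using E_subset(2)[OF assms(1-3), of x] assms(4) by simp
qed

text \<open>Countable additivity is applied to the successive differences of the sets; by finite
  additivity the partial sums are the projections \<open>E (S n)\<close>.\<close>

lemma E_incseq:
  assumes "range S \<subseteq> sets M" "incseq S"
  shows "(\<lambda>k. E (S k) x) \<longlonglongrightarrow> E (\<Union>k. S k) x"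
proof -
  have D: "range (disjointed S) \<subseteq> sets M"
    using assms(1) by (rule sets.range_disjointed_sets)
  have "(\<lambda>n. \<Sum>i<Suc n. E (disjointed S i) x) \<longlonglongrightarrow> E (\<Union>i. disjointed S i) x"
    using E_sums[OF D disjoint_family_disjointed, of x] LIMSEQ_Suc unfolding sums_def by blast
  moreover have "(\<Sum>i<Suc n. E (disjointed S i) x) = E (S n) x" for n
  proof -
    have "(\<Union>i\<in>{0..<Suc n}. disjointed S i) = S n"
      unfolding finite_UN_disjointed_eq using assms(2)
      by (auto simp: incseq_def less_Suc_eq_le) blast
    moreover have "E (\<Union>i\<in>{0..<Suc n}. disjointed S i) = (\<Sum>i\<in>{0..<Suc n}. E (disjointed S i))"
      using D disjoint_family_disjointed[of S]
      by (intro E_UN) (auto simp: disjoint_family_on_def)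
    ultimately show ?thesis
      by (simp add: blinfun.sum_left blinfun.add_left lessThan_atLeast0)
  qed
  ultimately show ?thesis
    by (simp add: UN_disjointed_eq)
qed

section \<open>The complex structure given by \<open>J\<close>\<close>

lemma norm_J: "norm (J x) = norm x"
  by (simp add: norm_eq_sqrt_inner J_skew J_J)

lemma inner_J_self: "inner (J x) x = 0"
  using J_skew[of x x] by (simp add: inner_commute)

text \<open>Scalar multiplication by a complex number when the imaginary unit acts as
  \<open>J\<close>.\<close>

definition cop :: "complex \<Rightarrow> 'a \<Rightarrow>\<^sub>L 'a"
  where "cop z = Re z *\<^sub>R id_blinfun + Im z *\<^sub>R J"

lemma cop_apply: "cop z x = Re z *\<^sub>R x + Im z *\<^sub>R J x"
  by (simp add: cop_def blinfun.add_left blinfun.scaleR_left)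

lemma cop_add: "cop (z + w) = cop z + cop w"
  by (simp add: cop_def algebra_simps)

lemma cop_mult: "cop (z * w) = cop z o\<^sub>L cop w"
  by (rule blinfun_eqI) (simp add: cop_apply blinfun.add_right blinfun.scaleR_right J_J algebra_simps)

lemma cop_0 [simp]: "cop 0 = 0"
  by (simp add: cop_def)

lemma cop_1 [simp]: "cop 1 = id_blinfun"
  by (simp add: cop_def)

text \<open>The vectors \<open>x\<close> and \<open>J x\<close> are orthogonal and of equal length,
  so Pythagoras applies.\<close>

lemma norm_cop: "norm (cop z x) = norm z * norm x"
proof -
  have "(norm (cop z x))\<^sup>2 = (norm z * norm x)\<^sup>2"
    using norm_add_Pythagorean[of "Re z *\<^sub>R x" "Im z *\<^sub>R J x"] inner_J_self[of x]
    by (simp add: cop_apply orthogonal_def inner_commute norm_J cmod_power2 power_mult_distrib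
        distrib_right)
  then show ?thesis
    by (simp add: power2_eq_iff_nonneg)
qed

lemma E_cop: "A \<in> sets M \<Longrightarrow> E A (cop z x) = cop z (E A x)"
  by (simp add: cop_apply blinfun.add_right blinfun.scaleR_right E_J)

section \<open>Integrals of simple functions\<close>

definition sint :: "('w \<Rightarrow> complex) \<Rightarrow> 'a \<Rightarrow>\<^sub>L 'a"
  where "sint F = (\<Sum>z\<in>F ` space M. E (F -` {z} \<inter> space M) o\<^sub>L cop z)"

lemma E_fibers:
  assumes h: "simple_function M h" and Z: "Z \<subseteq> h ` space M"
  shows "E (h -` Z \<inter> space M) = (\<Sum>z\<in>Z. E (h -` {z} \<inter> space M))"
proof -
  have "finite Z"
    using Z simple_functionD(1)[OF h] by (rule finite_subset)
  then have "E (\<Union>z\<in>Z. h -` {z} \<inter> space M) = (\<Sum>z\<in>Z. E (h -` {z} \<inter> space M))"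
    using simple_functionD(2)[OF h] by (intro E_UN) (auto simp: disjoint_family_on_def)
  moreover have "(\<Union>z\<in>Z. h -` {z} \<inter> space M) = h -` Z \<inter> space M"
    by auto
  ultimately show ?thesis
    by simp
qed

text \<open>Fibres of \<open>h\<close> on which \<open>\<phi>\<close> takes the same value are
  merged by additivity. With \<open>h\<close> the pair of two simple functions and
  \<open>\<phi>\<close> a projection, sum or product, this writes all the integrals over one common
  partition.\<close>

lemma sint_comp:
  assumes h: "simple_function M h"
  shows "sint (\<lambda>\<omega>. \<phi> (h \<omega>)) = (\<Sum>z\<in>h ` space M. E (h -` {z} \<inter> space M) o\<^sub>L cop (\<phi> z))"
proof -
  let ?Z = "h ` space M"
  have img: "(\<lambda>\<omega>. \<phi> (h \<omega>)) ` space M = \<phi> ` ?Z"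
    by auto
  have "E ((\<lambda>\<omega>. \<phi> (h \<omega>)) -` {c} \<inter> space M) = (\<Sum>z\<in>{z \<in> ?Z. \<phi> z = c}. E (h -` {z} \<inter> space M))"
    for c
  proof -
    have "(\<lambda>\<omega>. \<phi> (h \<omega>)) -` {c} \<inter> space M = h -` {z \<in> ?Z. \<phi> z = c} \<inter> space M"
      by auto
    then show ?thesis
      using E_fibers[OF h, of "{z \<in> ?Z. \<phi> z = c}"] by auto
  qed
  then have "sint (\<lambda>\<omega>. \<phi> (h \<omega>)) =
      (\<Sum>c\<in>\<phi> ` ?Z. \<Sum>z\<in>{z \<in> ?Z. \<phi> z = c}. E (h -` {z} \<inter> space M) o\<^sub>L cop (\<phi> z))"
    unfolding sint_def img
    by (intro sum.cong refl blinfun_eqI) (auto simp: blinfun.sum_left intro!: sum.cong)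
  also have "\<dots> = (\<Sum>z\<in>?Z. E (h -` {z} \<inter> space M) o\<^sub>L cop (\<phi> z))"
    using simple_functionD(1)[OF h] by (rule sum.image_gen[symmetric])
  finally show ?thesis .
qed

lemma sint_const: "sint (\<lambda>_. z) = cop z"
proof (cases "space M = {}")
  \<comment> \<open>The sum over an empty set of values is zero, which is still
    \<open>cop z\<close>: here \<open>E (space M) = E {} = 0\<close>, and so the whole space is
    trivial.\<close>
  case True
  then have "x = 0" for x :: 'a
    using E_space[of x] by simp
  then show ?thesis
    by (intro blinfun_eqI) metis
next
  case False
  then have "(\<lambda>_. z) ` space M = {z}"
    by auto
  then show ?thesis
    by (intro blinfun_eqI) (simp add: sint_def E_space)
qed

lemma sint_add:
  assumes "simple_function M F" "simple_function M G"
  shows "sint (\<lambda>\<omega>. F \<omega> + G \<omega>) = sint F + sint G"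
proof -
  let ?h = "\<lambda>\<omega>. (F \<omega>, G \<omega>)"
  have h: "simple_function M ?h"
    using assms by simp
  show ?thesis
    using sint_comp[OF h, of "\<lambda>z. fst z + snd z"] sint_comp[OF h, of fst] sint_comp[OF h, of snd]
    by (intro blinfun_eqI)
      (simp add: blinfun.sum_left blinfun.add_left blinfun.add_right cop_add sum.distrib)
qed

text \<open>Over the common partition the mixed terms vanish, because the projections of distinct
  fibres annihilate each other, and \<open>cop\<close> passes through the projections.\<close>

lemma sint_mult:
  assumes "simple_function M F" "simple_function M G"
  shows "sint (\<lambda>\<omega>. F \<omega> * G \<omega>) = sint F o\<^sub>L sint G"
proof (rule blinfun_eqI)
  fix x
  let ?h = "\<lambda>\<omega>. (F \<omega>, G \<omega>)"
  let ?P = "\<lambda>z. E (?h -` {z} \<inter> space M)"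
  have h: "simple_function M ?h"
    using assms by simp
  note fin = simple_functionD(1)[OF h] and meas = simple_functionD(2)[OF h]
  have *: "?P z (cop (fst z) (?P w (cop (snd w) x))) =
      (if w = z then ?P z (cop (fst z * snd z) x) else 0)" for z w
  proof (cases "w = z")
    case True
    then show ?thesis
      using meas by (simp add: E_cop[symmetric] E_idem cop_mult)
  next
    case False
    then have "?P z (?P w y) = 0" for y
      using meas by (intro E_disjoint) auto
    then show ?thesis
      using meas False by (simp add: E_cop[symmetric])
  qed
  have "sint F (sint G x) = (\<Sum>z\<in>?h ` space M. \<Sum>w\<in>?h ` space M.
      ?P z (cop (fst z) (?P w (cop (snd w) x))))"
    using sint_comp[OF h, of fst] sint_comp[OF h, of snd]
    by (subst sum.swap) (simp add: blinfun.sum_left blinfun.sum_right)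
  also have "\<dots> = (\<Sum>z\<in>?h ` space M. ?P z (cop (fst z * snd z) x))"
    unfolding * using fin by (intro sum.cong refl) (simp add: sum.delta)
  also have "\<dots> = sint (\<lambda>\<omega>. F \<omega> * G \<omega>) x"
    using sint_comp[OF h, of "\<lambda>z. fst z * snd z"] by (simp add: blinfun.sum_left)
  finally show "sint (\<lambda>\<omega>. F \<omega> * G \<omega>) x = (sint F o\<^sub>L sint G) x"
    by simp
qed

text \<open>The summands lie in the mutually orthogonal ranges of the fibre projections, so
  Pythagoras gives the sum of squares.\<close>

lemma norm_sint_sq:
  assumes F: "simple_function M F"
  shows "(norm (sint F x))\<^sup>2 =
    (\<Sum>z\<in>F ` space M. (norm z)\<^sup>2 * (norm (E (F -` {z} \<inter> space M) x))\<^sup>2)"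
proof -
  let ?P = "\<lambda>z. E (F -` {z} \<inter> space M)"
  note fin = simple_functionD(1)[OF F] and meas = simple_functionD(2)[OF F]
  have "pairwise (\<lambda>z w. orthogonal (?P z (cop z x)) (?P w (cop w x))) (F ` space M)"
  proof (rule pairwiseI)
    fix z w :: complex assume "z \<noteq> w"
    then have "?P z (?P w (cop w x)) = 0"
      using meas by (intro E_disjoint) auto
    then show "orthogonal (?P z (cop z x)) (?P w (cop w x))"
      using meas by (simp add: orthogonal_def E_sym)
  qed
  then have "(norm (\<Sum>z\<in>F ` space M. ?P z (cop z x)))\<^sup>2 = (\<Sum>z\<in>F ` space M. (norm (?P z (cop z x)))\<^sup>2)"
    using fin by (intro norm_sum_Pythagorean)
  then show ?thesis
    using meas by (simp add: sint_def blinfun.sum_left E_cop norm_cop power_mult_distrib)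
qed

lemma norm_sint_le:
  assumes F: "simple_function M F" and C: "\<And>\<omega>. \<omega> \<in> space M \<Longrightarrow> norm (F \<omega>) \<le> C" "0 \<le> C"
  shows "norm (sint F) \<le> C"
proof (rule norm_blinfun_bound[OF C(2)])
  fix x
  let ?P = "\<lambda>z. E (F -` {z} \<inter> space M)"
  note meas = simple_functionD(2)[OF F]
  have "(norm (sint F x))\<^sup>2 \<le> (\<Sum>z\<in>F ` space M. C\<^sup>2 * (norm (?P z x))\<^sup>2)"
    unfolding norm_sint_sq[OF F] using C
    by (intro sum_mono mult_right_mono power_mono) auto
  also have "\<dots> = C\<^sup>2 * (\<Sum>z\<in>F ` space M. inner (?P z x) x)"
    using meas by (simp add: sum_distrib_left inner_E)
  \<comment> \<open>The fibre projections add up to the identity, seen as the integral of the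
    constant 1.\<close>
  also have "(\<Sum>z\<in>F ` space M. inner (?P z x) x) = inner (sint (\<lambda>_. 1) x) x"
    using sint_comp[OF F, of "\<lambda>_. 1"] by (simp add: blinfun.sum_left inner_sum_left)
  also have "\<dots> = (norm x)\<^sup>2"
    by (simp add: sint_const power2_norm_eq_inner)
  finally have "(norm (sint F x))\<^sup>2 \<le> (C * norm x)\<^sup>2"
    by (simp add: power_mult_distrib)
  then show "norm (sint F x) \<le> C * norm x"
    using C(2) by (simp add: power2_le_iff_abs_le)
qed

section \<open>The integral as an operator norm limit: algebra, norm bound, uniqueness\<close>

definition integ :: "('w \<Rightarrow> complex) \<Rightarrow> ('a \<Rightarrow>\<^sub>L 'a) \<Rightarrow> bool"
  where "integ g A \<longleftrightarrow> (\<exists>F. (\<forall>j. simple_function M (F j)) \<and>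
           uniform_limit (space M) F g sequentially \<and> (\<lambda>j. sint (F j)) \<longlonglongrightarrow> A)"

lemma integ_cong: "(\<And>\<omega>. \<omega> \<in> space M \<Longrightarrow> g \<omega> = h \<omega>) \<Longrightarrow> integ g A \<longleftrightarrow> integ h A"
  by (simp add: integ_def cong: uniform_limit_cong')

lemma integ_simple: "simple_function M F \<Longrightarrow> integ F (sint F)"
  unfolding integ_def by (intro exI[of _ "\<lambda>_. F"]) (auto intro: uniform_limit_const)

lemma integ_bounded:
  assumes "integ g A"
  shows "bounded (g ` space M)"
proof -
  obtain F where F: "\<And>j. simple_function M (F j)" "uniform_limit (space M) F g sequentially"
    using assms unfolding integ_def by blast
  obtain j where j: "\<And>\<omega>. \<omega> \<in> space M \<Longrightarrow> dist (F j \<omega>) (g \<omega>) < 1"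
    using uniform_limitD[OF F(2), of 1] eventually_happens'[OF sequentially_bot] by force
  obtain C where C: "\<forall>z\<in>F j ` space M. norm z \<le> C"
    using simple_functionD(1)[OF F(1)] finite_imp_bounded bounded_iff by metis
  have "norm (g \<omega>) \<le> C + 1" if "\<omega> \<in> space M" for \<omega>
    using j[OF that] C that norm_triangle_sub[of "g \<omega>" "F j \<omega>"]
    by (fastforce simp: dist_norm norm_minus_commute)
  then show ?thesis
    by (auto simp: bounded_iff)
qed

lemma integ_add:
  assumes "integ g A" "integ h B"
  shows "integ (\<lambda>\<omega>. g \<omega> + h \<omega>) (A + B)"
proof -
  obtain F G where F: "\<And>j. simple_function M (F j)" "uniform_limit (space M) F g sequentially"
      "(\<lambda>j. sint (F j)) \<longlonglongrightarrow> A"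
    and G: "\<And>j. simple_function M (G j)" "uniform_limit (space M) G h sequentially"
      "(\<lambda>j. sint (G j)) \<longlonglongrightarrow> B"
    using assms unfolding integ_def by blast
  show ?thesis
    unfolding integ_def
  proof (intro exI[of _ "\<lambda>j \<omega>. F j \<omega> + G j \<omega>"] conjI allI)
    show "uniform_limit (space M) (\<lambda>j \<omega>. F j \<omega> + G j \<omega>) (\<lambda>\<omega>. g \<omega> + h \<omega>) sequentially"
      using F(2) G(2) by (rule uniform_limit_add)
    show "(\<lambda>j. sint (\<lambda>\<omega>. F j \<omega> + G j \<omega>)) \<longlonglongrightarrow> A + B"
      using tendsto_add[OF F(3) G(3)] F(1) G(1) by (simp add: sint_add)
  qed (use F(1) G(1) in \<open>auto intro: simple_function_compose2\<close>)
qed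

lemma integ_mult:
  assumes g: "integ g A" and h: "integ h B"
  shows "integ (\<lambda>\<omega>. g \<omega> * h \<omega>) (A o\<^sub>L B)"
proof -
  obtain F G where F: "\<And>j. simple_function M (F j)" "uniform_limit (space M) F g sequentially"
      "(\<lambda>j. sint (F j)) \<longlonglongrightarrow> A"
    and G: "\<And>j. simple_function M (G j)" "uniform_limit (space M) G h sequentially"
      "(\<lambda>j. sint (G j)) \<longlonglongrightarrow> B"
    using assms unfolding integ_def by blast
  show ?thesis
    unfolding integ_def
  proof (intro exI[of _ "\<lambda>j \<omega>. F j \<omega> * G j \<omega>"] conjI allI)
    \<comment> \<open>Products preserve uniform convergence here because both limit functions are
      bounded.\<close>
    show "uniform_limit (space M) (\<lambda>j \<omega>. F j \<omega> * G j \<omega>) (\<lambda>\<omega>. g \<omega> * h \<omega>) sequentially"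
      using F(2) G(2) integ_bounded[OF g] integ_bounded[OF h] by (rule uniform_lim_mult)
    show "(\<lambda>j. sint (\<lambda>\<omega>. F j \<omega> * G j \<omega>)) \<longlonglongrightarrow> (A o\<^sub>L B)"
      using bounded_bilinear.tendsto[OF bounded_bilinear_blinfun_compose F(3) G(3)] F(1) G(1)
      by (simp add: sint_mult)
  qed (use F(1) G(1) in \<open>auto intro: simple_function_compose2\<close>)
qed

lemma norm_integ_le:
  assumes g: "integ g A" and C: "\<And>\<omega>. \<omega> \<in> space M \<Longrightarrow> norm (g \<omega>) \<le> C" "0 \<le> C"
  shows "norm A \<le> C"
proof (rule field_le_epsilon)
  fix e :: real assume "e > 0"
  obtain F where F: "\<And>j. simple_function M (F j)" "uniform_limit (space M) F g sequentially"
      "(\<lambda>j. sint (F j)) \<longlonglongrightarrow> A"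
    using g unfolding integ_def by blast
  have "\<forall>\<^sub>F j in sequentially. norm (sint (F j)) \<le> C + e"
    using uniform_limitD[OF F(2) \<open>e > 0\<close>]
  proof eventually_elim
    case (elim j)
    show ?case
    proof (rule norm_sint_le[OF F(1)])
      fix \<omega> assume \<omega>: "\<omega> \<in> space M"
      have "norm (F j \<omega>) \<le> norm (g \<omega>) + dist (F j \<omega>) (g \<omega>)"
        by (metis dist_norm norm_triangle_sub)
      then show "norm (F j \<omega>) \<le> C + e"
        using elim C(1) \<omega> by fastforce
    qed (use C(2) \<open>e > 0\<close> in simp)
  qed
  then show "norm A \<le> C + e"
    using tendsto_upperbound[OF tendsto_norm[OF F(3)]] by simp
qed

text \<open>By additivity and multiplicativity \<open>A - B\<close> is an integral of the zero
  function, and the sup-norm bound makes it zero. The value therefore does not depend on the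
  approximating sequence.\<close>

lemma integ_unique:
  assumes "integ g A" "integ g B"
  shows "A = B"
proof -
  have "integ (\<lambda>_. - 1) (cop (- 1))"
    using integ_simple[of "\<lambda>_. - 1"] by (simp add: sint_const)
  then have "integ (\<lambda>\<omega>. g \<omega> + - 1 * g \<omega>) (A + (cop (- 1) o\<^sub>L B))"
    using assms by (intro integ_add integ_mult)
  then have "norm (A + (cop (- 1) o\<^sub>L B)) \<le> 0"
    by (rule norm_integ_le) auto
  moreover have "A + (cop (- 1) o\<^sub>L B) = A - B"
    by (rule blinfun_eqI) (simp add: cop_apply blinfun.add_left blinfun.diff_left)
  ultimately show ?thesis
    by simp
qed

section \<open>Existence and calculus for bounded measurable functions\<close>

lemma simple_uniform_approx:
  fixes g :: "'w \<Rightarrow> complex"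
  assumes g[measurable]: "g \<in> borel_measurable M" and b: "bounded (g ` space M)"
  obtains F where "\<And>j. simple_function M (F j)" "uniform_limit (space M) F g sequentially"
proof -
  \<comment> \<open>Real and imaginary parts are rounded down to multiples of 1/(j+1). The error is
    at most 2/(j+1), and boundedness of \<open>g\<close> leaves only finitely many values.\<close>
  define r where "r = (\<lambda>(j::nat) (t::real). real_of_int \<lfloor>real (Suc j) * t\<rfloor> / real (Suc j))"
  define F where "F = (\<lambda>j \<omega>. Complex (r j (Re (g \<omega>))) (r j (Im (g \<omega>))))"
  obtain B where B: "\<And>\<omega>. \<omega> \<in> space M \<Longrightarrow> norm (g \<omega>) \<le> B"
    using b by (auto simp: bounded_iff)
  have r_err: "\<bar>r j t - t\<bar> \<le> 1 / real (Suc j)" for j t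
  proof -
    have "\<bar>real_of_int \<lfloor>real (Suc j) * t\<rfloor> - real (Suc j) * t\<bar> \<le> 1"
      by linarith
    then have "\<bar>real_of_int \<lfloor>real (Suc j) * t\<rfloor> - real (Suc j) * t\<bar> / real (Suc j) \<le> 1 / real (Suc j)"
      by (rule divide_right_mono) simp
    moreover have "r j t - t = (real_of_int \<lfloor>real (Suc j) * t\<rfloor> - real (Suc j) * t) / real (Suc j)"
      by (simp add: r_def field_simps)
    ultimately show ?thesis
      by simp
  qed
  have "simple_function M (F j)" for j
  proof (rule simple_function_borel_measurable)
    have "F j = (\<lambda>\<omega>. complex_of_real (r j (Re (g \<omega>))) + \<i> * complex_of_real (r j (Im (g \<omega>))))"
      by (simp add: F_def Complex_eq)
    also have "\<dots> \<in> borel_measurable M"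
      unfolding r_def by measurable
    finally show "F j \<in> borel_measurable M" .
    define K where "K = (\<lambda>i::int. real_of_int i / real (Suc j)) ` {\<lfloor>- (real (Suc j) * B)\<rfloor> .. \<lfloor>real (Suc j) * B\<rfloor>}"
    have r: "r j t \<in> K" if "\<bar>t\<bar> \<le> B" for t
    proof -
      have "\<bar>real (Suc j) * t\<bar> \<le> real (Suc j) * B"
        using that by (simp add: abs_mult)
      then have "\<lfloor>real (Suc j) * t\<rfloor> \<in> {\<lfloor>- (real (Suc j) * B)\<rfloor> .. \<lfloor>real (Suc j) * B\<rfloor>}"
        unfolding atLeastAtMost_iff abs_le_iff by (simp only: floor_mono minus_le_iff)
      then show ?thesis
        unfolding K_def r_def by (rule imageI)
    qed
    have "F j ` space M \<subseteq> (\<lambda>(a, b). Complex a b) ` (K \<times> K)"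
    proof
      fix z assume "z \<in> F j ` space M"
      then obtain \<omega> where \<omega>: "\<omega> \<in> space M" "z = F j \<omega>"
        by blast
      have "\<bar>Re (g \<omega>)\<bar> \<le> B" "\<bar>Im (g \<omega>)\<bar> \<le> B"
        using B[OF \<omega>(1)] abs_Re_le_cmod[of "g \<omega>"] abs_Im_le_cmod[of "g \<omega>"] by linarith+
      then show "z \<in> (\<lambda>(a, b). Complex a b) ` (K \<times> K)"
        using \<omega> r by (force simp: F_def)
    qed
    then show "finite (F j ` space M)"
      by (rule finite_subset) (simp add: K_def)
  qed
  moreover have "uniform_limit (space M) F g sequentially"
  proof (rule uniform_limitI)
    fix e :: real assume "e > 0"
    have "(\<lambda>j. 2 / real (Suc j)) \<longlonglongrightarrow> 0"
      by (intro LIMSEQ_Suc lim_const_over_n)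
    then have "\<forall>\<^sub>F j in sequentially. 2 / real (Suc j) < e"
      using \<open>e > 0\<close> by (rule order_tendstoD)
    then show "\<forall>\<^sub>F j in sequentially. \<forall>\<omega>\<in>space M. dist (F j \<omega>) (g \<omega>) < e"
    proof eventually_elim
      case (elim j)
      have "dist (F j \<omega>) (g \<omega>) \<le> 1 / real (Suc j) + 1 / real (Suc j)" for \<omega>
      proof -
        have "dist (F j \<omega>) (g \<omega>) \<le> \<bar>Re (F j \<omega> - g \<omega>)\<bar> + \<bar>Im (F j \<omega> - g \<omega>)\<bar>"
          unfolding dist_norm by (rule cmod_le)
        also have "\<dots> = \<bar>r j (Re (g \<omega>)) - Re (g \<omega>)\<bar> + \<bar>r j (Im (g \<omega>)) - Im (g \<omega>)\<bar>"
          by (simp add: F_def)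
        finally show ?thesis
          using add_mono[OF r_err r_err] by (rule order_trans)
      qed
      moreover have "1 / real (Suc j) + 1 / real (Suc j) < e"
        using elim by (simp only: flip: add_divide_distrib) simp
      ultimately show ?case
        using le_less_trans by blast
    qed
  qed
  ultimately show ?thesis
    by (rule that)
qed

definition bmf :: "('w \<Rightarrow> complex) set"
  where "bmf = {g \<in> borel_measurable M. bounded (g ` space M)}"

lemma bmfI: "g \<in> borel_measurable M \<Longrightarrow> (\<And>\<omega>. \<omega> \<in> space M \<Longrightarrow> norm (g \<omega>) \<le> C) \<Longrightarrow> g \<in> bmf"
  by (auto simp: bmf_def bounded_iff)

lemma bmfE:
  assumes "g \<in> bmf"
  obtains C where "0 \<le> C" "\<And>\<omega>. \<omega> \<in> space M \<Longrightarrow> norm (g \<omega>) \<le> C"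
proof -
  obtain C where "0 < C" "\<forall>z\<in>g ` space M. norm z \<le> C"
    using assms unfolding bmf_def bounded_pos by blast
  then show ?thesis
    by (intro that[of C]) simp_all
qed

text \<open>By \<open>norm_sint_le\<close> the simple integral is a contraction for the sup norm, so
  a uniformly convergent sequence of simple functions has Cauchy integrals in the complete space of
  bounded operators.\<close>

lemma integ_exists:
  assumes "g \<in> bmf"
  shows "\<exists>A. integ g A"
proof -
  obtain F where F: "\<And>j. simple_function M (F j)" "uniform_limit (space M) F g sequentially"
    using assms simple_uniform_approx[of g] unfolding bmf_def by blast
  have "Cauchy (\<lambda>j. sint (F j))"
  proof (rule metric_CauchyI)
    fix e :: real assume "e > 0"
    then obtain N where N: "\<And>j \<omega>. N \<le> j \<Longrightarrow> \<omega> \<in> space M \<Longrightarrow> dist (F j \<omega>) (g \<omega>) < e / 4"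
      using uniform_limitD[OF F(2), of "e / 4"] by (auto simp: eventually_sequentially)
    have "dist (sint (F m)) (sint (F n)) < e" if mn: "N \<le> m" "N \<le> n" for m n
    proof -
      have s: "simple_function M (\<lambda>\<omega>. F m \<omega> - F n \<omega>)"
        using F(1) by (auto intro: simple_function_compose2)
      have "norm (sint (\<lambda>\<omega>. F m \<omega> - F n \<omega>)) \<le> e / 2"
      proof (rule norm_sint_le[OF s])
        fix \<omega> assume "\<omega> \<in> space M"
        then show "norm (F m \<omega> - F n \<omega>) \<le> e / 2"
          using N[OF mn(1), of \<omega>] N[OF mn(2), of \<omega>] dist_triangle2[of "F m \<omega>" "F n \<omega>" "g \<omega>"]
          by (simp add: dist_norm)
      qed (use \<open>e > 0\<close> in simp)
      moreover have "sint (F m) = sint (\<lambda>\<omega>. F m \<omega> - F n \<omega>) + sint (F n)"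
        using sint_add[OF s F(1)[of n]] by simp
      ultimately show ?thesis
        using \<open>e > 0\<close> by (simp add: dist_norm)
    qed
    then show "\<exists>N. \<forall>m\<ge>N. \<forall>n\<ge>N. dist (sint (F m)) (sint (F n)) < e"
      by blast
  qed
  then obtain A where "(\<lambda>j. sint (F j)) \<longlonglongrightarrow> A"
    using convergent_eq_Cauchy by blast
  then show ?thesis
    using F unfolding integ_def by blast
qed

definition cint :: "('w \<Rightarrow> complex) \<Rightarrow> 'a \<Rightarrow>\<^sub>L 'a"
  where "cint g = (THE A. integ g A)"

lemma integ_cint: "g \<in> bmf \<Longrightarrow> integ g (cint g)"
  unfolding cint_def using integ_exists integ_unique by (metis theI)

lemma cint_eqI: "integ g A \<Longrightarrow> cint g = A"
  unfolding cint_def using integ_unique by blast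

lemma cint_cong: "(\<And>\<omega>. \<omega> \<in> space M \<Longrightarrow> g \<omega> = h \<omega>) \<Longrightarrow> cint g = cint h"
  unfolding cint_def using integ_cong[of g h] by presburger

lemma cint_add: "g \<in> bmf \<Longrightarrow> h \<in> bmf \<Longrightarrow> cint (\<lambda>\<omega>. g \<omega> + h \<omega>) = cint g + cint h"
  by (intro cint_eqI integ_add integ_cint)

lemma cint_mult: "g \<in> bmf \<Longrightarrow> h \<in> bmf \<Longrightarrow> cint (\<lambda>\<omega>. g \<omega> * h \<omega>) x = cint g (cint h x)"
  using cint_eqI[OF integ_mult[OF integ_cint integ_cint]] by simp

lemma cint_const: "cint (\<lambda>_. z) = cop z"
  using cint_eqI[OF integ_simple] sint_const by simp

lemma cint_indicator:
  assumes "A \<in> sets M"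
  shows "cint (indicator A) = E A"
proof -
  have s: "simple_function M (indicator A :: _ \<Rightarrow> complex)"
    using assms by simp
  let ?h = "indicator A :: 'w \<Rightarrow> complex"
  \<comment> \<open>The indicator may omit one of the values 0 and 1. The sum is nevertheless
    extended to both, since the fibre of an omitted value is empty.\<close>
  have "(\<lambda>z. z) ` ?h ` space M \<subseteq> {0, 1}"
    by (auto simp: indicator_def)
  then have "sint ?h = (\<Sum>z\<in>{0, 1}. E (?h -` {z} \<inter> space M) o\<^sub>L cop z)"
    unfolding sint_def
  proof (intro sum.mono_neutral_left ballI)
    fix z assume "z \<in> {0, 1} - ?h ` space M"
    then have "?h -` {z} \<inter> space M = {}"
      by auto
    then show "E (?h -` {z} \<inter> space M) o\<^sub>L cop z = 0"
      by simp
  qed auto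
  moreover have "?h -` {1} \<inter> space M = A"
    using sets.sets_into_space[OF assms] by (auto simp: indicator_def)
  ultimately have "sint ?h = E A"
    by (intro blinfun_eqI) simp
  then show ?thesis
    using cint_eqI[OF integ_simple[OF s]] by simp
qed

lemma norm_cint_le:
  assumes "g \<in> bmf" "\<And>\<omega>. \<omega> \<in> space M \<Longrightarrow> norm (g \<omega>) \<le> C" "0 \<le> C"
  shows "norm (cint g x) \<le> C * norm x"
  using norm_integ_le[OF integ_cint[OF assms(1)] assms(2,3)] norm_blinfun[of "cint g" x]
  by (meson mult_right_mono norm_ge_zero order_trans)

lemma bmf_add [intro]: "g \<in> bmf \<Longrightarrow> h \<in> bmf \<Longrightarrow> (\<lambda>\<omega>. g \<omega> + h \<omega>) \<in> bmf"
  by (simp add: bmf_def bounded_plus_comp borel_measurable_add)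

lemma bmf_mult [intro]:
  assumes "g \<in> bmf" "h \<in> bmf"
  shows "(\<lambda>\<omega>. g \<omega> * h \<omega>) \<in> bmf"
proof -
  obtain C D where "0 \<le> C" "\<And>\<omega>. \<omega> \<in> space M \<Longrightarrow> norm (g \<omega>) \<le> C"
      "0 \<le> D" "\<And>\<omega>. \<omega> \<in> space M \<Longrightarrow> norm (h \<omega>) \<le> D"
    using bmfE[OF assms(1)] bmfE[OF assms(2)] by metis
  then have "norm (g \<omega> * h \<omega>) \<le> C * D" if "\<omega> \<in> space M" for \<omega>
    using that by (simp add: norm_mult mult_mono)
  moreover have "(\<lambda>\<omega>. g \<omega> * h \<omega>) \<in> borel_measurable M"
    using assms by (intro borel_measurable_times) (auto simp: bmf_def)
  ultimately show ?thesis
    by (rule bmfI[rotated])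
qed

lemma bmf_const [intro, simp]: "(\<lambda>_. z) \<in> bmf"
  by (rule bmfI[of _ "norm z"]) auto

lemma bmf_indicator [intro]: "A \<in> sets M \<Longrightarrow> indicator A \<in> bmf"
  by (rule bmfI[of _ 1]) (auto simp: indicator_def)

text \<open>\<open>E A\<close> is itself the integral of an indicator, so both claims are
  multiplicativity of the calculus.\<close>

lemma E_cint:
  assumes "A \<in> sets M" "g \<in> bmf"
  shows "E A (cint g x) = cint (\<lambda>\<omega>. indicator A \<omega> * g \<omega>) x" (is ?L)
    and "cint g (E A x) = cint (\<lambda>\<omega>. indicator A \<omega> * g \<omega>) x" (is ?R)
proof -
  show ?L
    using assms by (simp add: cint_mult bmf_indicator cint_indicator)
  show ?R
    using cint_mult[OF assms(2) bmf_indicator[OF assms(1)], of x]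
    by (simp only: cint_indicator[OF assms(1)] mult.commute)
qed

section \<open>The scalar measures and the isometry of the integral\<close>

definition emeas :: "'a \<Rightarrow> 'w measure"
  where "emeas x = measure_of (space M) (sets M) (\<lambda>A. ennreal (inner (E A x) x))"

lemma space_emeas [simp]: "space (emeas x) = space M"
  by (simp add: emeas_def)

lemma sets_emeas [simp, measurable_cong]: "sets (emeas x) = sets M"
  by (simp add: emeas_def sets.sigma_sets_eq)

text \<open>Countable additivity in the strong topology passes to \<open>inner (E A x) x\<close>;
  without it \<open>measure_of\<close> would return the zero measure. The squared norm appears
  because \<open>E A\<close> is a symmetric idempotent.\<close>

lemma emeasure_emeas:
  assumes "A \<in> sets M"
  shows "emeasure (emeas x) A = ennreal ((norm (E A x))\<^sup>2)"
proof -
  let ?\<mu> = "\<lambda>A. ennreal (inner (E A x) x)"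
  have "countably_additive (sets M) ?\<mu>"
  proof (rule countably_additiveI)
    fix S :: "nat \<Rightarrow> 'w set"
    assume S: "range S \<subseteq> sets M" "disjoint_family S" "\<Union> (range S) \<in> sets M"
    have "(\<lambda>i. inner (E (S i) x) x) sums inner (E (\<Union>i. S i) x) x"
      using E_sums[OF S(1,2)] by (rule bounded_linear.sums[OF bounded_linear_inner_left])
    moreover have "0 \<le> inner (E (S i) x) x" for i
      using S(1) inner_E[of "S i" x] by auto
    ultimately show "(\<Sum>i. ?\<mu> (S i)) = ?\<mu> (\<Union> (range S))"
      by (intro suminf_ennreal_eq)
  qed
  moreover have "positive (sets M) ?\<mu>"
    by (simp add: positive_def)
  ultimately have "emeasure (emeas x) A = ?\<mu> A"
    unfolding emeas_def using assms sets.sigma_algebra_axioms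
    by (intro emeasure_measure_of_sigma)
  then show ?thesis
    using assms by (simp add: inner_E)
qed

lemma nn_integral_sint:
  assumes F: "simple_function M F"
  shows "(\<integral>\<^sup>+\<omega>. ennreal ((norm (F \<omega>))\<^sup>2) \<partial>emeas x) = ennreal ((norm (sint F x))\<^sup>2)"
proof -
  let ?S = "\<lambda>z. F -` {z} \<inter> space M"
  note fin = simple_functionD(1)[OF F] and meas = simple_functionD(2)[OF F]
  have "(\<integral>\<^sup>+\<omega>. ennreal ((norm (F \<omega>))\<^sup>2) \<partial>emeas x) =
      (\<integral>\<^sup>+\<omega>. (\<Sum>z\<in>F ` space M. ennreal ((norm z)\<^sup>2) * indicator (?S z) \<omega>) \<partial>emeas x)"
  proof (rule nn_integral_cong)
    fix \<omega> assume "\<omega> \<in> space (emeas x)"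
    then have "(\<Sum>z\<in>F ` space M. ennreal ((norm z)\<^sup>2) * indicator (?S z) \<omega>) =
        (\<Sum>z\<in>F ` space M. if z = F \<omega> then ennreal ((norm z)\<^sup>2) else 0)"
      by (intro sum.cong) (auto simp: indicator_def)
    then show "ennreal ((norm (F \<omega>))\<^sup>2) =
        (\<Sum>z\<in>F ` space M. ennreal ((norm z)\<^sup>2) * indicator (?S z) \<omega>)"
      using \<open>\<omega> \<in> space (emeas x)\<close> fin by simp
  qed
  also have "\<dots> = (\<Sum>z\<in>F ` space M. ennreal ((norm z)\<^sup>2) * emeasure (emeas x) (?S z))"
    using meas by (simp add: nn_integral_sum nn_integral_cmult_indicator)
  also have "\<dots> = ennreal ((norm (sint F x))\<^sup>2)"
    using meas by (simp add: emeasure_emeas norm_sint_sq[OF F] ennreal_mult'[symmetric] sum_ennreal)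
  finally show ?thesis .
qed

text \<open>For simple functions both sides are the same finite sum, and dominated convergence
  carries the identity over to the uniform limit. The measure is finite, with total mass the squared
  norm of \<open>x\<close>.\<close>

lemma nn_integral_cint:
  assumes g: "g \<in> bmf"
  shows "(\<integral>\<^sup>+\<omega>. ennreal ((norm (g \<omega>))\<^sup>2) \<partial>emeas x) = ennreal ((norm (cint g x))\<^sup>2)"
proof -
  have [measurable]: "g \<in> borel_measurable M"
    using g by (simp add: bmf_def)
  obtain F where F: "\<And>j. simple_function M (F j)" "uniform_limit (space M) F g sequentially"
      "(\<lambda>j. sint (F j)) \<longlonglongrightarrow> cint g"
    using integ_cint[OF g] unfolding integ_def by blast
  have [measurable]: "F j \<in> borel_measurable M" for j
    using F(1) by (rule borel_measurable_simple_function)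
  obtain C where C: "0 \<le> C" "\<And>\<omega>. \<omega> \<in> space M \<Longrightarrow> norm (g \<omega>) \<le> C"
    using bmfE[OF g] by blast
  \<comment> \<open>From index \<open>N\<close> on the approximants stay within 1 of
    \<open>g\<close>, which makes the constant \<open>(C + 1)\<^sup>2\<close> a dominating function
    for the shifted sequence.\<close>
  obtain N where N: "\<And>j \<omega>. N \<le> j \<Longrightarrow> \<omega> \<in> space M \<Longrightarrow> dist (F j \<omega>) (g \<omega>) < 1"
    using uniform_limitD[OF F(2), of 1] by (auto simp: eventually_sequentially)
  have "(\<lambda>j. \<integral>\<^sup>+\<omega>. ennreal ((norm (F (j + N) \<omega>))\<^sup>2) \<partial>emeas x)
      \<longlonglongrightarrow> (\<integral>\<^sup>+\<omega>. ennreal ((norm (g \<omega>))\<^sup>2) \<partial>emeas x)"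
  proof (rule nn_integral_dominated_convergence[where w = "\<lambda>_. ennreal ((C + 1)\<^sup>2)"])
    show "AE \<omega> in emeas x. ennreal ((norm (F (j + N) \<omega>))\<^sup>2) \<le> ennreal ((C + 1)\<^sup>2)" for j
    proof (rule AE_I2)
      fix \<omega> assume "\<omega> \<in> space (emeas x)"
      then have "norm (F (j + N) \<omega>) \<le> C + 1"
        using N[of "j + N" \<omega>] C(2)[of \<omega>] norm_triangle_sub[of "F (j + N) \<omega>" "g \<omega>"]
        by (simp add: dist_norm)
      then show "ennreal ((norm (F (j + N) \<omega>))\<^sup>2) \<le> ennreal ((C + 1)\<^sup>2)"
        by (intro ennreal_leI power_mono) auto
    qed
    show "(\<integral>\<^sup>+\<omega>. ennreal ((C + 1)\<^sup>2) \<partial>emeas x) < \<infinity>"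
      by (simp add: emeasure_emeas ennreal_mult_less_top)
    show "AE \<omega> in emeas x. (\<lambda>j. ennreal ((norm (F (j + N) \<omega>))\<^sup>2)) \<longlonglongrightarrow> ennreal ((norm (g \<omega>))\<^sup>2)"
      using LIMSEQ_ignore_initial_segment[OF tendsto_uniform_limitI[OF F(2)]]
      by (intro AE_I2 tendsto_ennrealI tendsto_intros) auto
  qed measurable
  moreover have "(\<lambda>j. \<integral>\<^sup>+\<omega>. ennreal ((norm (F (j + N) \<omega>))\<^sup>2) \<partial>emeas x)
      \<longlonglongrightarrow> ennreal ((norm (cint g x))\<^sup>2)"
    unfolding nn_integral_sint[OF F(1)]
    using LIMSEQ_ignore_initial_segment[OF F(3)]
    by (intro tendsto_ennrealI tendsto_intros blinfun.tendsto) auto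
  ultimately show ?thesis
    by (rule LIMSEQ_unique)
qed

section \<open>Truncation to sets on which a function is bounded\<close>

definition bsets :: "('w \<Rightarrow> complex) \<Rightarrow> 'w set set"
  where "bsets g = {A \<in> sets M. bounded (g ` A)}"

lemma bmf_indicator_mult:
  assumes "g \<in> borel_measurable M" "A \<in> sets M" "bounded (g ` A)"
  shows "(\<lambda>\<omega>. indicator A \<omega> * g \<omega>) \<in> bmf"
proof -
  obtain C where C: "0 < C" "\<forall>z\<in>g ` A. norm z \<le> C"
    using assms(3) unfolding bounded_pos by blast
  show ?thesis
  proof (rule bmfI)
    show "(\<lambda>\<omega>. indicator A \<omega> * g \<omega>) \<in> borel_measurable M"
      using assms(1,2) by measurable
    show "norm (indicator A \<omega> * g \<omega>) \<le> C" for \<omega>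
      using C by (auto simp: indicator_def)
  qed
qed

text \<open>A standard exhaustion of the space by sets from \<open>bsets g\<close>. Vectors are
  recovered from their localisations as limits along it.\<close>

definition levels :: "('w \<Rightarrow> complex) \<Rightarrow> nat \<Rightarrow> 'w set"
  where "levels g k = {\<omega> \<in> space M. norm (g \<omega>) \<le> real k}"

lemma levels_bsets: "g \<in> borel_measurable M \<Longrightarrow> levels g k \<in> bsets g"
  by (auto simp: bsets_def levels_def bounded_iff)

lemma incseq_levels: "incseq (levels g)"
  by (rule incseq_SucI) (auto simp: levels_def)

lemma UN_levels: "(\<Union>k. levels g k) = space M"
  using real_arch_simple by (auto simp: levels_def)

lemma levels_tendsto:
  assumes "g \<in> borel_measurable M"
  shows "(\<lambda>k. E (levels g k) x) \<longlonglongrightarrow> x"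
proof -
  have "range (levels g) \<subseteq> sets M"
    using levels_bsets[OF assms] by (auto simp: bsets_def)
  from E_incseq[OF this incseq_levels] show ?thesis
    by (simp add: UN_levels E_space)
qed

lemma eq_if_levels:
  assumes "g \<in> borel_measurable M" "\<And>k. E (levels g k) x = E (levels g k) y"
  shows "x = y"
  using levels_tendsto[OF assms(1), of x] levels_tendsto[OF assms(1), of y] assms(2)
  by (simp add: LIMSEQ_unique)

text \<open>
  Unbounded operators are handled entirely through this property, for a family \<open>\<A>\<close> of sets on which
  \<open>g\<close> is bounded, so that only integrals of bounded functions occur.
\<close>

definition acts_as :: "'w set set \<Rightarrow> ('a \<rightharpoonup> 'a) \<Rightarrow> ('w \<Rightarrow> complex) \<Rightarrow> bool"
  where "acts_as \<A> T g \<longleftrightarrow> (\<forall>A\<in>\<A>.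
           (\<forall>x\<in>dom T. E A (the (T x)) = cint (\<lambda>\<omega>. indicator A \<omega> * g \<omega>) x) \<and>
           (\<forall>x. E A x = x \<longrightarrow> T x = Some (cint (\<lambda>\<omega>. indicator A \<omega> * g \<omega>) x)))"

lemma acts_asD1:
  "acts_as \<A> T g \<Longrightarrow> A \<in> \<A> \<Longrightarrow> T x = Some y \<Longrightarrow> E A y = cint (\<lambda>\<omega>. indicator A \<omega> * g \<omega>) x"
  unfolding acts_as_def by force

lemma acts_asD2:
  "acts_as \<A> T g \<Longrightarrow> A \<in> \<A> \<Longrightarrow> E A x = x \<Longrightarrow> T x = Some (cint (\<lambda>\<omega>. indicator A \<omega> * g \<omega>) x)"
  unfolding acts_as_def by blast

text \<open>This is \<open>Q_op\<close> with the real part and the squared modulus of the point as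
  free real parameters, and with the same domain, that of the square of \<open>T\<close>.\<close>

definition quad :: "real \<Rightarrow> real \<Rightarrow> ('a \<rightharpoonup> 'a) \<Rightarrow> 'a \<rightharpoonup> 'a"
  where "quad u r T = (\<lambda>x. map_option (\<lambda>z. z - (2 * u) *\<^sub>R the (T x) + r *\<^sub>R x) ((T \<circ>\<^sub>m T) x))"

lemma indicator_square: "indicator A \<omega> * (indicator A \<omega> * z) = indicator A \<omega> * (z :: complex)"
  by (simp add: indicator_def)

lemma indicator_square_quad:
  "(indicator A \<omega> * z) * (indicator A \<omega> * z) + (of_real a * (indicator A \<omega> * z) + of_real b * indicator A \<omega>) =
    indicator A \<omega> * (z\<^sup>2 + of_real a * z + of_real b :: complex)"
  by (simp add: indicator_def power2_eq_square)

lemma cop_of_real: "cop (of_real a) x = a *\<^sub>R x"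
  by (simp add: cop_apply)

text \<open>An indicator is idempotent, so the truncated polynomial in \<open>g\<close> is a
  polynomial in the truncated \<open>g\<close>, with the indicator in place of 1. That is why the
  last term contains \<open>E A x\<close> instead of \<open>x\<close>.\<close>

lemma cint_quad:
  assumes g: "g \<in> borel_measurable M" and A: "A \<in> bsets g"
  defines "G \<equiv> cint (\<lambda>\<omega>. indicator A \<omega> * g \<omega>)"
  shows "cint (\<lambda>\<omega>. indicator A \<omega> * ((g \<omega>)\<^sup>2 - of_real (2 * u) * g \<omega> + of_real r)) x =
    G (G x) - (2 * u) *\<^sub>R G x + r *\<^sub>R E A x"
proof -
  let ?g = "\<lambda>\<omega>. indicator A \<omega> * g \<omega>"
  have A': "A \<in> sets M" "bounded (g ` A)"
    using A by (auto simp: bsets_def)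
  have b: "?g \<in> bmf" "indicator A \<in> bmf"
    using g A' by (auto intro: bmf_indicator_mult)
  note c = bmf_mult[OF bmf_const[of "of_real (- (2 * u))"] b(1)]
    bmf_mult[OF bmf_const[of "of_real r"] b(2)]
  have "cint (\<lambda>\<omega>. indicator A \<omega> * ((g \<omega>)\<^sup>2 - of_real (2 * u) * g \<omega> + of_real r)) =
      cint (\<lambda>\<omega>. ?g \<omega> * ?g \<omega> + (of_real (- (2 * u)) * ?g \<omega> + of_real r * indicator A \<omega>))"
    by (simp only: indicator_square_quad) simp
  also have "\<dots> = cint (\<lambda>\<omega>. ?g \<omega> * ?g \<omega>) +
      (cint (\<lambda>\<omega>. of_real (- (2 * u)) * ?g \<omega>) + cint (\<lambda>\<omega>. of_real r * indicator A \<omega>))"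
    by (simp only: cint_add[OF bmf_mult[OF b(1) b(1)] bmf_add[OF c]] cint_add[OF c])
  finally show ?thesis
    using b A'(1)
    by (simp add: blinfun.add_left cint_mult cint_const cop_of_real cint_indicator G_def
        del: of_real_mult of_real_minus)
qed

lemma E_cint_indicator:
  assumes g: "g \<in> borel_measurable M" and A: "A \<in> bsets g"
  shows "E A (cint (\<lambda>\<omega>. indicator A \<omega> * g \<omega>) x) = cint (\<lambda>\<omega>. indicator A \<omega> * g \<omega>) x"
    and "cint (\<lambda>\<omega>. indicator A \<omega> * g \<omega>) (E A x) = cint (\<lambda>\<omega>. indicator A \<omega> * g \<omega>) x"
proof -
  have "A \<in> sets M" "(\<lambda>\<omega>. indicator A \<omega> * g \<omega>) \<in> bmf"
    using g A by (auto simp: bsets_def intro: bmf_indicator_mult)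
  from E_cint[OF this, of x]
  show "E A (cint (\<lambda>\<omega>. indicator A \<omega> * g \<omega>) x) = cint (\<lambda>\<omega>. indicator A \<omega> * g \<omega>) x"
    and "cint (\<lambda>\<omega>. indicator A \<omega> * g \<omega>) (E A x) = cint (\<lambda>\<omega>. indicator A \<omega> * g \<omega>) x"
    unfolding indicator_square .
qed

text \<open>The truncated integral of \<open>g\<close> maps into the range of \<open>E A\<close> and
  ignores everything outside it. The description of \<open>T\<close> can therefore be applied twice
  in a row, both to a vector of the domain and to a localised vector.\<close>

lemma acts_as_quad:
  assumes g: "g \<in> borel_measurable M" and T: "acts_as (bsets g) T g"
  shows "acts_as (bsets g) (quad u r T) (\<lambda>\<omega>. (g \<omega>)\<^sup>2 - of_real (2 * u) * g \<omega> + of_real r)"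
  unfolding acts_as_def
proof (intro ballI conjI allI impI)
  fix A x assume A: "A \<in> bsets g"
  let ?G = "cint (\<lambda>\<omega>. indicator A \<omega> * g \<omega>)"
  note inv = E_cint_indicator[OF g A]
  {
    assume "x \<in> dom (quad u r T)"
    then obtain y z where T1: "T x = Some y" and T2: "T y = Some z"
      by (auto simp: quad_def map_comp_def split: option.splits)
    have "E A y = ?G x"
      by (rule acts_asD1[OF T A T1])
    moreover have "E A z = ?G y"
      by (rule acts_asD1[OF T A T2])
    ultimately have "E A z = ?G (?G x)"
      using inv(2)[of y] by simp
    then show "E A (the (quad u r T x)) =
        cint (\<lambda>\<omega>. indicator A \<omega> * ((g \<omega>)\<^sup>2 - of_real (2 * u) * g \<omega> + of_real r)) x"
      unfolding cint_quad[OF g A] using \<open>E A y = ?G x\<close> T1 T2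
      by (simp add: quad_def blinfun.add_right blinfun.diff_right blinfun.scaleR_right)
  }
  {
    assume x: "E A x = x"
    have T1: "T x = Some (?G x)"
      by (rule acts_asD2[OF T A x])
    have T2: "T (?G x) = Some (?G (?G x))"
      by (rule acts_asD2[OF T A inv(1)])
    show "quad u r T x =
        Some (cint (\<lambda>\<omega>. indicator A \<omega> * ((g \<omega>)\<^sup>2 - of_real (2 * u) * g \<omega> + of_real r)) x)"
      unfolding cint_quad[OF g A] using T1 T2 x by (simp add: quad_def)
  }
qed

section \<open>Invertibility of an operator in terms of its symbol\<close>

context
  fixes g p :: "'w \<Rightarrow> complex" and Q :: "'a \<rightharpoonup> 'a"
  assumes g: "g \<in> borel_measurable M" and p: "p \<in> borel_measurable M"
    and pg: "\<And>A. A \<in> bsets g \<Longrightarrow> bounded (p ` A)"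
    and Q: "acts_as (bsets g) Q p"
begin

lemma bmf_indicator_symbol: "A \<in> bsets g \<Longrightarrow> (\<lambda>\<omega>. indicator A \<omega> * p \<omega>) \<in> bmf"
  using p pg by (intro bmf_indicator_mult) (auto simp: bsets_def)

lemma sublevel_sets: "{\<omega> \<in> space M. norm (p \<omega>) < d} \<in> sets M"
  using p by measurable

text \<open>The inverse is the integral of 1/p, with the value 0 on the null set where p is small.
  It inverts \<open>Q\<close> on each localisation, and the exhaustion by \<open>levels\<close>
  extends this to the whole domain.\<close>

lemma inverse_if_symbol_bounded_below:
  assumes "d > 0" and null: "E {\<omega> \<in> space M. norm (p \<omega>) < d} = 0"
  obtains B where "\<forall>x y. Q x = Some y \<longrightarrow> B y = x" "bounded_linear B" "closure (ran Q) = UNIV"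
proof -
  let ?U = "{\<omega> \<in> space M. norm (p \<omega>) < d}"
  define h where "h = (\<lambda>\<omega>. if norm (p \<omega>) < d then 0 else inverse (p \<omega>))"
  have h: "h \<in> bmf"
  proof (rule bmfI)
    show "h \<in> borel_measurable M"
      unfolding h_def using p by measurable
    show "norm (h \<omega>) \<le> inverse d" for \<omega>
      using \<open>d > 0\<close> by (auto simp: h_def norm_inverse le_imp_inverse_le)
  qed
  \<comment> \<open>The product of \<open>h\<close> and the truncated symbol is the indicator of
    \<open>A - ?U\<close>. As \<open>?U\<close> is null, its projection is all of
    \<open>E A\<close>.\<close>
  have cancel: "cint h (cint (\<lambda>\<omega>. indicator A \<omega> * p \<omega>) x) = E A x" if A: "A \<in> bsets g" for A x
  proof -
    have A': "A \<in> sets M"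
      using A by (simp add: bsets_def)
    have "cint h (cint (\<lambda>\<omega>. indicator A \<omega> * p \<omega>) x) = cint (\<lambda>\<omega>. h \<omega> * (indicator A \<omega> * p \<omega>)) x"
      using cint_mult[OF h bmf_indicator_symbol[OF A]] by simp
    also have "cint (\<lambda>\<omega>. h \<omega> * (indicator A \<omega> * p \<omega>)) = cint (indicator (A - ?U))"
      using \<open>d > 0\<close> by (intro cint_cong) (auto simp: h_def indicator_def intro!: left_inverse)
    also have "\<dots> = E (A - ?U)"
      using A' sublevel_sets by (intro cint_indicator) auto
    also have "\<dots> = E (A - ?U) + E (A \<inter> ?U)"
      using E_null_subset[OF _ sublevel_sets _ null, of "A \<inter> ?U"] A' sublevel_sets by simp
    also have "\<dots> = E ((A - ?U) \<union> (A \<inter> ?U))"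
      using A' sublevel_sets by (intro E_Un[symmetric]) auto
    also have "(A - ?U) \<union> (A \<inter> ?U) = A"
      by blast
    finally show ?thesis .
  qed
  have commute: "cint h (cint (\<lambda>\<omega>. indicator A \<omega> * p \<omega>) x) =
      cint (\<lambda>\<omega>. indicator A \<omega> * p \<omega>) (cint h x)" if "A \<in> bsets g" for A x
    unfolding cint_mult[OF h bmf_indicator_symbol[OF that], symmetric]
      cint_mult[OF bmf_indicator_symbol[OF that] h, symmetric]
    by (simp only: mult.commute)
  have lev: "levels g k \<in> bsets g" "levels g k \<in> sets M" for k
    using levels_bsets[OF g] by (auto simp: bsets_def)
  have "cint h y = x" if "Q x = Some y" for x y
  proof -
    have "cint h (E (levels g k) y) = E (levels g k) x" for k
      using acts_asD1[OF Q lev(1) that] cancel[OF lev(1)] by simp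
    moreover have "(\<lambda>k. cint h (E (levels g k) y)) \<longlonglongrightarrow> cint h y"
      by (intro blinfun.tendsto tendsto_const levels_tendsto[OF g])
    ultimately show ?thesis
      using levels_tendsto[OF g, of x] LIMSEQ_unique by simp
  qed
  moreover have "closure (ran Q) = UNIV"
  proof -
    \<comment> \<open>Each truncation \<open>E (levels g k) y\<close> is attained, at the localised
      vector \<open>cint h (E (levels g k) y)\<close>, and the truncations converge to
      \<open>y\<close>.\<close>
    have "y \<in> closure (ran Q)" for y
      unfolding closure_sequential
    proof (intro exI[of _ "\<lambda>k. E (levels g k) y"] conjI allI)
      fix k
      let ?x = "cint h (E (levels g k) y)"
      have "E (levels g k) ?x = ?x"
        by (simp only: E_cint(2)[OF lev(2) h]) (simp only: E_cint(1)[OF lev(2) h, symmetric] E_idem[OF lev(2)])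
      then have "Q ?x = Some (cint (\<lambda>\<omega>. indicator (levels g k) \<omega> * p \<omega>) ?x)"
        by (rule acts_asD2[OF Q lev(1)])
      also have "cint (\<lambda>\<omega>. indicator (levels g k) \<omega> * p \<omega>) ?x = E (levels g k) y"
        by (simp only: commute[OF lev(1), symmetric] cancel[OF lev(1)] E_idem[OF lev(2)])
      finally show "E (levels g k) y \<in> ran Q"
        by (rule ranI)
    qed (rule levels_tendsto[OF g])
    then show ?thesis
      by blast
  qed
  ultimately show ?thesis
    using that blinfun.bounded_linear_right by blast
qed

text \<open>A nonzero vector in the range of the projection for the set where |p| < d is mapped by
  \<open>Q\<close> to a vector at most d times as long.\<close>

lemma not_bounded_below_if_essential_zero:
  assumes ess: "\<And>d. d > 0 \<Longrightarrow> E {\<omega> \<in> space M. norm (p \<omega>) < d} \<noteq> 0"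
    and sub: "\<And>d. {\<omega> \<in> space M. norm (p \<omega>) < d} \<in> bsets g"
  shows "\<exists>x y. Q x = Some y \<and> norm x > C * norm y"
proof -
  \<comment> \<open>Chosen so that |C| d < 1.\<close>
  define d where "d = inverse (\<bar>C\<bar> + 1)"
  have "d > 0"
    by (simp add: d_def)
  let ?U = "{\<omega> \<in> space M. norm (p \<omega>) < d}"
  obtain x0 where "E ?U x0 \<noteq> 0"
    using ess[OF \<open>d > 0\<close>] blinfun_eqI[of "E ?U" 0] by auto
  define x where "x = E ?U x0"
  have x: "x \<noteq> 0" "E ?U x = x"
    using \<open>E ?U x0 \<noteq> 0\<close> sublevel_sets by (simp_all add: x_def E_idem)
  define y where "y = cint (\<lambda>\<omega>. indicator ?U \<omega> * p \<omega>) x"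
  have "norm y \<le> d * norm x"
    unfolding y_def using \<open>d > 0\<close>
    by (intro norm_cint_le bmf_indicator_symbol sub) (auto simp: indicator_def)
  then have "C * norm y \<le> \<bar>C\<bar> * (d * norm x)"
    by (meson abs_ge_self abs_ge_zero mult_mono norm_ge_zero order_trans)
  also have "\<dots> = (\<bar>C\<bar> * d) * norm x"
    by simp
  also have "\<dots> < 1 * norm x"
    using x(1) by (intro mult_strict_right_mono) (simp_all add: d_def field_simps)
  finally show ?thesis
    using acts_asD2[OF Q sub x(2)] unfolding y_def by auto
qed

text \<open>\<open>Q\<close> is only a partial map here, so subtraction is done after localisation:
  on the range of \<open>E (levels g k)\<close> the map \<open>Q\<close> is a bounded linear
  integral, and there the difference of the two preimages lies in the kernel.\<close>

lemma inj_if_kernel_trivial: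
  assumes ker: "\<And>x. Q x = Some 0 \<Longrightarrow> x = 0" and "Q x1 = Some y" "Q x2 = Some y"
  shows "x1 = x2"
proof (rule eq_if_levels[OF g])
  fix k
  let ?P = "cint (\<lambda>\<omega>. indicator (levels g k) \<omega> * p \<omega>)"
  let ?d = "E (levels g k) (x1 - x2)"
  have lev: "levels g k \<in> bsets g" "levels g k \<in> sets M"
    using levels_bsets[OF g] by (auto simp: bsets_def)
  have "Q ?d = Some (?P ?d)"
    using lev by (intro acts_asD2[OF Q]) (simp_all add: E_idem)
  also have "?P ?d = cint (\<lambda>\<omega>. indicator (levels g k) \<omega> * (indicator (levels g k) \<omega> * p \<omega>)) (x1 - x2)"
    by (rule E_cint(2)[OF lev(2) bmf_indicator_symbol[OF lev(1)]])
  also have "\<dots> = ?P x1 - ?P x2"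
    by (simp only: indicator_square blinfun.diff_right)
  also have "\<dots> = 0"
    using acts_asD1[OF Q lev(1) assms(2)] acts_asD1[OF Q lev(1) assms(3)] by simp
  finally show "E (levels g k) x1 = E (levels g k) x2"
    using ker by (fastforce simp: blinfun.diff_right)
qed

end

end

section \<open>Spectral integrals on Clifford modules\<close>

text \<open>The value of \<open>adjoint_op\<close> is a definite description. It is resolved by
  taking real parts: two candidates have the same real inner product with every vector, hence
  coincide.\<close>

lemma adjoint_op_total_inner:
  fixes A B :: "('h::real_inner, 'n::{finite,linorder}) bop"
  assumes "adjoint_op (total_op A) = total_op B"
  shows "inner (A x) y = inner x (B y)"
proof -
  let ?P = "\<lambda>z. \<forall>x\<in>dom (total_op A). cinner (the (total_op A x)) y = cinner x z"
  have "adjoint_op (total_op A) y = Some (B y)"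
    unfolding assms by (simp add: total_op_def)
  then have ex: "\<exists>z. ?P z" and the: "(THE z. ?P z) = B y"
    unfolding adjoint_op_def by (auto split: if_splits)
  have "z = z'" if "?P z" "?P z'" for z z'
  proof -
    have "cinner x z = cinner x z'" for x :: "('h, 'n) cmodule"
      using that by (simp add: total_op_def dom_def)
    then have "inner x z = inner x z'" for x
      by (metis cRe_cinner)
    then have "inner (z - z') (z - z') = 0"
      by (simp add: inner_diff_right)
    then show ?thesis
      by simp
  qed
  then have "\<exists>!z. ?P z"
    using ex by blast
  from theI'[OF this] have "?P (THE z. ?P z)" .
  then have "cinner (A x) y = cinner x (B y)"
    unfolding the by (simp add: total_op_def dom_def)
  then show ?thesis
    by (metis cRe_cinner)
qed

lemma spectral_calculus_Clifford:
  fixes E :: "'n clifford set \<Rightarrow> ('h::{real_inner,banach}, 'n::{finite,linorder}) bop"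
  assumes E: "spectral_measure M E" and J: "imaginary_operator J" and EJ: "associated_with J M E"
  shows "spectral_calculus M E J"
proof
  fix A :: "'n clifford set" and x y :: "('h, 'n) cmodule"
  assume A: "A \<in> sets M"
  then have P: "orthogonal_projection (E A)"
    using E by (simp add: spectral_measure_def)
  then show "inner (E A x) y = inner x (E A y)"
    by (intro adjoint_op_total_inner) (simp add: orthogonal_projection_def)
  show "E A (E A x) = E A x"
    using P unfolding orthogonal_projection_def by (metis blinfun_apply_blinfun_compose)
  show "E A (J x) = J (E A x)"
    using EJ A unfolding associated_with_def by (metis blinfun_apply_blinfun_compose)
next
  fix B :: "nat \<Rightarrow> 'n clifford set" and x
  assume "range B \<subseteq> sets M" "disjoint_family B"
  then show "(\<lambda>i. E (B i) x) sums E (\<Union>i. B i) x"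
    using E by (simp add: spectral_measure_def)
next
  show "E (space M) x = x" for x
    using E by (simp add: spectral_measure_def)
next
  fix x y :: "('h, 'n) cmodule"
  have adj: "adjoint_op (total_op J) = total_op (- J)"
    using J by (simp add: imaginary_operator_def)
  from adjoint_op_total_inner[OF adj] show "inner (J x) y = - inner x (J y)"
    by (simp add: blinfun.minus_left)
  \<comment> \<open>With adjoint \<open>- J\<close>, unitarity reads J (- J) = I.\<close>
  have "(total_op J \<circ>\<^sub>m total_op (- J)) x = Some x"
    using J unfolding imaginary_operator_def unitary_op_def adj by simp
  then show "J (J x) = - x"
    by (simp add: map_comp_def total_op_def blinfun.minus_left blinfun.minus_right minus_equation_iff)
qed

locale clifford_calculus = spectral_calculus M E J
  for M :: "'n::{finite,linorder} clifford measure"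
    and E :: "'n clifford set \<Rightarrow> ('h::{real_inner,banach}, 'n) bop"
    and J :: "('h, 'n) bop" +
  fixes \<II> :: "'n clifford"
  assumes \<II>: "\<II> \<in> imag_sphere"
begin

section \<open>Identification of the slice with the complex plane\<close>

definition emb :: "complex \<Rightarrow> 'n clifford"
  where "emb z = ipoint \<II> (Re z) (Im z)"

text \<open>Defined on the whole algebra, so that it is bounded linear and hence measurable. It
  inverts the isometry \<open>emb\<close> on the slice.\<close>

definition proj :: "'n clifford \<Rightarrow> complex"
  where "proj c = Complex (cRe c) (iIm \<II> c)"

lemma proj_emb [simp]: "proj (emb z) = z"
  by (simp add: proj_def emb_def cRe_ipoint iIm_ipoint \<II> complex_eq_iff)

lemma emb_islice [simp]: "emb z \<in> islice \<II>"
  by (auto simp: emb_def islice_def)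

lemma islice_iff: "c \<in> islice \<II> \<longleftrightarrow> (\<exists>z. c = emb z)"
  unfolding islice_def emb_def by (auto intro: exI[of _ "Complex _ _"])

lemma emb_proj: "c \<in> islice \<II> \<Longrightarrow> emb (proj c) = c"
  by (auto simp: islice_iff)

lemma norm_emb [simp]: "norm (emb z) = norm z"
  by (simp add: emb_def norm_ipoint \<II> cmod_def)

lemma emb_diff: "emb (z - w) = emb z - emb w"
  by (simp add: emb_def ipoint_def algebra_simps)

lemma dist_emb [simp]: "dist (emb z) (emb w) = dist z w"
  unfolding dist_norm emb_diff[symmetric] norm_emb ..

lemma norm_proj: "c \<in> islice \<II> \<Longrightarrow> norm (proj c) = norm c"
  by (auto simp: islice_iff)

lemma bounded_linear_emb: "bounded_linear emb"
proof (rule bounded_linear_intro)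
  show "norm (emb z) \<le> norm z * 1" for z
    by simp
qed (simp_all add: emb_def ipoint_def algebra_simps)

lemma bounded_linear_proj: "bounded_linear proj"
proof -
  have "proj = (\<lambda>c. complex_of_real (c $ {}) + \<i> * complex_of_real (inner c \<II>))"
    by (simp add: proj_def cRe_def iIm_def Complex_eq fun_eq_iff)
  moreover have "bounded_linear (\<lambda>c. complex_of_real (c $ {}) + \<i> * complex_of_real (inner c \<II>))"
    by (intro bounded_linear_add bounded_linear_compose[OF bounded_linear_of_real]
        bounded_linear_vec_nth bounded_linear_inner_left
        bounded_linear_compose[OF bounded_linear_mult_right])
  ultimately show ?thesis
    by simp
qed

lemma measurable_proj: "f \<in> borel_measurable M \<Longrightarrow> (\<lambda>\<omega>. proj (f \<omega>)) \<in> borel_measurable M"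
  by (rule borel_measurable_continuous_on[OF
        bounded_linear.continuous_on[OF bounded_linear_proj continuous_on_id]])

text \<open>The slice is the fixed point set of the continuous map that applies \<open>proj\<close>
  and then \<open>emb\<close>.\<close>

lemma closed_islice: "closed (islice \<II>)"
proof -
  have "islice \<II> = {c. emb (proj c) = c}"
    using emb_proj emb_islice by (metis (mono_tags, lifting) Collect_cong Collect_mem_eq)
  moreover have "closed {c. emb (proj c) = c}"
    by (intro closed_Collect_eq continuous_intros bounded_linear.continuous_on[OF bounded_linear_emb]
        bounded_linear.continuous_on[OF bounded_linear_proj])
  ultimately show ?thesis
    by simp
qed

section \<open>Agreement of the Clifford and the complex integrals for bounded functions\<close>

lemma simple_integral_op_eq_sint:
  assumes "simple_function M F"
  shows "simple_integral_op \<II> M E J F = sint (\<lambda>\<omega>. proj (F \<omega>))"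
  \<comment> \<open>\<open>proj\<close> may identify distinct values of \<open>F\<close>;
    \<open>sint_comp\<close> sums over the values of \<open>F\<close> itself, as
    \<open>simple_integral_op\<close> does.\<close>
  unfolding sint_comp[OF assms] simple_integral_op_def
  by (intro sum.cong refl blinfun_eqI)
    (simp add: cop_apply proj_def blinfun.add_left blinfun.add_right blinfun.scaleR_left
      blinfun.scaleR_right)

text \<open>Approximating sequences are carried back and forth by \<open>proj\<close> and
  \<open>emb\<close>, which are bounded linear and so preserve uniform limits. Thus both definite
  descriptions describe the same operator.\<close>

lemma bounded_integral_op_limit_iff:
  assumes f: "f ` space M \<subseteq> islice \<II>"
  shows "(\<exists>F :: nat \<Rightarrow> 'n clifford \<Rightarrow> 'n clifford.
           (\<forall>j. simple_function M (F j) \<and> F j ` space M \<subseteq> islice \<II>) \<and>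
           uniform_limit (space M) F f sequentially \<and>
           (\<lambda>j. simple_integral_op \<II> M E J (F j)) \<longlonglongrightarrow> A) \<longleftrightarrow>
        integ (\<lambda>\<omega>. proj (f \<omega>)) A" (is "?L \<longleftrightarrow> ?R")
proof
  assume ?L
  then obtain F where s: "\<And>j. simple_function M (F j)" and
    lim: "uniform_limit (space M) F f sequentially"
      "(\<lambda>j. simple_integral_op \<II> M E J (F j)) \<longlonglongrightarrow> A"
    by (elim exE conjE) metis
  show ?R
    unfolding integ_def
  proof (intro exI[of _ "\<lambda>j \<omega>. proj (F j \<omega>)"] conjI allI)
    show "simple_function M (\<lambda>\<omega>. proj (F j \<omega>))" for j
      using s by (rule simple_function_compose1)
    show "uniform_limit (space M) (\<lambda>j \<omega>. proj (F j \<omega>)) (\<lambda>\<omega>. proj (f \<omega>)) sequentially"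
      using lim(1) by (rule bounded_linear.uniform_limit[OF bounded_linear_proj])
    show "(\<lambda>j. sint (\<lambda>\<omega>. proj (F j \<omega>))) \<longlonglongrightarrow> A"
      using lim(2) unfolding simple_integral_op_eq_sint[OF s] .
  qed
next
  assume ?R
  then obtain F where F: "\<And>j. simple_function M (F j)"
      "uniform_limit (space M) F (\<lambda>\<omega>. proj (f \<omega>)) sequentially" "(\<lambda>j. sint (F j)) \<longlonglongrightarrow> A"
    unfolding integ_def by blast
  have s: "simple_function M (\<lambda>\<omega>. emb (F j \<omega>))" for j
    using F(1) by (rule simple_function_compose1)
  have "uniform_limit (space M) (\<lambda>j \<omega>. emb (F j \<omega>)) (\<lambda>\<omega>. emb (proj (f \<omega>))) sequentially"
    using F(2) by (rule bounded_linear.uniform_limit[OF bounded_linear_emb])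
  moreover have "emb (proj (f \<omega>)) = f \<omega>" if "\<omega> \<in> space M" for \<omega>
    using f that by (intro emb_proj) blast
  ultimately have "uniform_limit (space M) (\<lambda>j \<omega>. emb (F j \<omega>)) f sequentially"
    by (simp add: uniform_limit_iff)
  then show ?L
    using F(3) s
    by (intro exI[of _ "\<lambda>j \<omega>. emb (F j \<omega>)"])
      (auto simp only: simple_integral_op_eq_sint[OF s] proj_emb emb_islice)
qed

lemma bounded_integral_op_eq_cint:
  "f ` space M \<subseteq> islice \<II> \<Longrightarrow> bounded_integral_op \<II> M E J f = cint (\<lambda>\<omega>. proj (f \<omega>))"
  by (simp only: bounded_integral_op_def cint_def bounded_integral_op_limit_iff)

section \<open>Integrals of unbounded functions by truncation\<close>

lemma scalar_measure_eq_emeas: "scalar_measure M E x = emeas x"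
  by (simp add: scalar_measure_def emeas_def cRe_cinner)

lemma bounded_proj_image: "bounded (f ` A) \<Longrightarrow> bounded ((\<lambda>\<omega>. proj (f \<omega>)) ` A)"
  using bounded_linear_image[OF _ bounded_linear_proj, of "f ` A"] by (simp add: image_image)

lemma bounded_integral_op_indicator:
  assumes f: "f ` space M \<subseteq> islice \<II>"
  shows "bounded_integral_op \<II> M E J (\<lambda>\<omega>. indicator S \<omega> *\<^sub>R f \<omega>) =
    cint (\<lambda>\<omega>. indicator S \<omega> * proj (f \<omega>))"
proof -
  have "indicator S \<omega> *\<^sub>R f \<omega> \<in> islice \<II>" if "\<omega> \<in> space M" for \<omega>
  proof -
    have "f \<omega> \<in> islice \<II>" "emb 0 = 0"
      using f that bounded_linear_emb by (auto simp: linear_simps(3))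
    then show ?thesis
      by (metis (no_types) emb_islice indicator_simps scaleR_one scaleR_zero_left)
  qed
  moreover have "proj (indicator S \<omega> *\<^sub>R f \<omega>) = indicator S \<omega> * proj (f \<omega>)" for \<omega>
    by (simp add: indicator_def linear_simps(3)[OF bounded_linear_proj])
  ultimately show ?thesis
    by (subst bounded_integral_op_eq_cint) auto
qed

text \<open>The relation under the definite description in the unbounded case of
  \<open>spectral_integral\<close>, transferred to complex functions.\<close>

definition truncation_limit :: "('n clifford \<Rightarrow> complex) \<Rightarrow> ('h, 'n) cmodule \<Rightarrow> ('h, 'n) cmodule \<Rightarrow> bool"
  where "truncation_limit g x y \<longleftrightarrow> (\<exists>S :: nat \<Rightarrow> 'n clifford set.
           (\<forall>j. S j \<in> bsets g \<and> S j \<subseteq> S (Suc j)) \<and> E (\<Union>j. S j) = id_blinfun \<and>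
           (\<lambda>j. cint (\<lambda>\<omega>. indicator (S j) \<omega> * g \<omega>) x) \<longlonglongrightarrow> y)"

lemma truncation_limit_levels:
  assumes g: "g \<in> borel_measurable M"
    and lim: "(\<lambda>k. cint (\<lambda>\<omega>. indicator (levels g k) \<omega> * g \<omega>) x) \<longlonglongrightarrow> y"
  shows "truncation_limit g x y"
  unfolding truncation_limit_def
proof (intro exI[of _ "levels g"] conjI allI)
  show "E (\<Union>k. levels g k) = id_blinfun"
    by (rule blinfun_eqI) (simp add: UN_levels E_space)
qed (use lim levels_bsets[OF g] incseq_levels in \<open>auto simp: incseq_Suc_iff\<close>)

text \<open>All three expressions are the integral of \<open>g\<close> over the intersection of
  \<open>A\<close> and \<open>B\<close>, applied to \<open>x\<close>.\<close>

lemma cint_indicator_Int: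
  assumes g: "g \<in> borel_measurable M" and A: "A \<in> bsets g" and B: "B \<in> bsets g"
  shows "E A (cint (\<lambda>\<omega>. indicator B \<omega> * g \<omega>) x) = cint (\<lambda>\<omega>. indicator A \<omega> * g \<omega>) (E B x)"
    and "E A (cint (\<lambda>\<omega>. indicator B \<omega> * g \<omega>) x) = E B (cint (\<lambda>\<omega>. indicator A \<omega> * g \<omega>) x)"
proof -
  have "A \<in> sets M" "B \<in> sets M" "(\<lambda>\<omega>. indicator A \<omega> * g \<omega>) \<in> bmf" "(\<lambda>\<omega>. indicator B \<omega> * g \<omega>) \<in> bmf"
    using g A B by (auto simp: bsets_def intro: bmf_indicator_mult)
  then show "E A (cint (\<lambda>\<omega>. indicator B \<omega> * g \<omega>) x) = cint (\<lambda>\<omega>. indicator A \<omega> * g \<omega>) (E B x)"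
    and "E A (cint (\<lambda>\<omega>. indicator B \<omega> * g \<omega>) x) = E B (cint (\<lambda>\<omega>. indicator A \<omega> * g \<omega>) x)"
    by (simp_all only: E_cint mult.left_commute[of "indicator A _" "indicator B _" "g _"])
qed

text \<open>After projection by \<open>E A\<close> the truncation to \<open>S j\<close> can be moved
  from the function to the vector, where \<open>E (S j) x\<close> tends to \<open>x\<close>. So
  every localisation of a limit is independent of the chosen sets, and uniqueness follows.\<close>

lemma truncation_limit_E:
  assumes g: "g \<in> borel_measurable M" and y: "truncation_limit g x y" and A: "A \<in> bsets g"
  shows "E A y = cint (\<lambda>\<omega>. indicator A \<omega> * g \<omega>) x"
proof -
  obtain S :: "nat \<Rightarrow> 'n clifford set" where S: "\<And>j. S j \<in> bsets g" "\<And>j. S j \<subseteq> S (Suc j)"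
    and US: "E (\<Union>j. S j) = id_blinfun"
    and lim: "(\<lambda>j. cint (\<lambda>\<omega>. indicator (S j) \<omega> * g \<omega>) x) \<longlonglongrightarrow> y"
    using y unfolding truncation_limit_def by blast
  have "(\<lambda>j. E (S j) x) \<longlonglongrightarrow> E (\<Union>j. S j) x"
    using S by (intro E_incseq incseq_SucI) (auto simp: bsets_def)
  then have "(\<lambda>j. cint (\<lambda>\<omega>. indicator A \<omega> * g \<omega>) (E (S j) x))
      \<longlonglongrightarrow> cint (\<lambda>\<omega>. indicator A \<omega> * g \<omega>) x"
    unfolding US by (intro blinfun.tendsto tendsto_const) simp
  moreover have "(\<lambda>j. E A (cint (\<lambda>\<omega>. indicator (S j) \<omega> * g \<omega>) x)) \<longlonglongrightarrow> E A y"
    using lim by (intro blinfun.tendsto tendsto_const)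
  ultimately show ?thesis
    unfolding cint_indicator_Int(1)[OF g A S(1)] using LIMSEQ_unique by blast
qed

lemma truncation_limit_unique:
  assumes g: "g \<in> borel_measurable M" and "truncation_limit g x y" "truncation_limit g x y'"
  shows "y = y'"
  by (rule eq_if_levels[OF g])
    (simp only: truncation_limit_E[OF g assms(2) levels_bsets[OF g]]
      truncation_limit_E[OF g assms(3) levels_bsets[OF g]])

text \<open>For j at most k, \<open>Y j\<close> is the projection of \<open>Y k\<close> to the
  smaller level set, so |Y k - Y j|^2 = |Y k|^2 - |Y j|^2. The squared norms increase and are
  bounded by the integral, hence are Cauchy, and so is \<open>Y\<close>.\<close>

lemma truncation_limit_exists:
  assumes g: "g \<in> borel_measurable M"
    and fin: "(\<integral>\<^sup>+\<omega>. ennreal ((norm (g \<omega>))\<^sup>2) \<partial>emeas x) < \<infinity>"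
  shows "\<exists>y. truncation_limit g x y"
proof -
  define Y where "Y k = cint (\<lambda>\<omega>. indicator (levels g k) \<omega> * g \<omega>) x" for k
  define I where "I = enn2real (\<integral>\<^sup>+\<omega>. ennreal ((norm (g \<omega>))\<^sup>2) \<partial>emeas x)"
  have I: "(\<integral>\<^sup>+\<omega>. ennreal ((norm (g \<omega>))\<^sup>2) \<partial>emeas x) = ennreal I" "0 \<le> I"
    unfolding I_def using fin by (simp_all only: ennreal_enn2real infinity_ennreal_def enn2real_nonneg)
  have lev: "levels g k \<in> bsets g" "levels g k \<in> sets M" for k
    using levels_bsets[OF g] by (auto simp: bsets_def)
  have bmf: "(\<lambda>\<omega>. indicator (levels g k) \<omega> * g \<omega>) \<in> bmf" for k
    using lev g by (auto simp: bsets_def intro: bmf_indicator_mult)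
  have bound: "(norm (Y k))\<^sup>2 \<le> I" for k
  proof -
    have "ennreal ((norm (Y k))\<^sup>2) \<le> ennreal I"
      unfolding Y_def nn_integral_cint[OF bmf, symmetric] I(1)[symmetric]
      by (intro nn_integral_mono ennreal_leI power_mono) (auto simp: indicator_def)
    then show ?thesis
      using I(2) by simp
  qed
  have pyth: "(norm (Y k - Y j))\<^sup>2 = (norm (Y k))\<^sup>2 - (norm (Y j))\<^sup>2" if "j \<le> k" for j k
  proof -
    have "levels g j \<subseteq> levels g k"
      using incseq_levels that by (auto simp: incseq_def)
    then have absorb: "indicator (levels g j) \<omega> * (indicator (levels g k) \<omega> * g \<omega>) = indicator (levels g j) \<omega> * g \<omega>"
      for \<omega>
      by (auto simp: indicator_def)
    have Yj: "E (levels g j) (Y k) = Y j"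
      unfolding Y_def E_cint(1)[OF lev(2) bmf] absorb ..
    have "(norm (Y k - Y j))\<^sup>2 = (norm (Y k))\<^sup>2 - 2 * inner (Y j) (Y k) + (norm (Y j))\<^sup>2"
      by (simp add: power2_norm_eq_inner inner_diff_left inner_diff_right inner_commute)
    also have "inner (Y j) (Y k) = (norm (Y j))\<^sup>2"
      using inner_E[OF lev(2), of j "Y k"] unfolding Yj .
    finally show ?thesis
      by simp
  qed
  have "mono (\<lambda>k. (norm (Y k))\<^sup>2)"
    using pyth by (intro monoI) (metis diff_ge_0_iff_ge zero_le_power2)
  then have "convergent (\<lambda>k. (norm (Y k))\<^sup>2)"
    using bound by (intro Bseq_mono_convergent BseqI'[of _ I]) (auto simp: mono_def)
  then have cauchy: "Cauchy (\<lambda>k. (norm (Y k))\<^sup>2)"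
    by (rule convergent_Cauchy)
  have "Cauchy Y"
  proof (rule metric_CauchyI)
    fix e :: real assume "e > 0"
    then obtain N where N: "\<And>m n. N \<le> m \<Longrightarrow> N \<le> n \<Longrightarrow> dist ((norm (Y m))\<^sup>2) ((norm (Y n))\<^sup>2) < e\<^sup>2"
      using metric_CauchyD[OF cauchy, of "e\<^sup>2"] by auto
    have le: "dist (Y m) (Y n) < e" if "N \<le> n" "n \<le> m" for m n
    proof -
      have "(norm (Y m - Y n))\<^sup>2 < e\<^sup>2"
        using N[of m n] that unfolding pyth[OF that(2)] by (simp add: dist_real_def)
      then show ?thesis
        using \<open>e > 0\<close> by (simp add: dist_norm power_less_imp_less_base)
    qed
    then have "dist (Y m) (Y n) < e" if "N \<le> m" "N \<le> n" for m n
      using that by (metis dist_commute nle_le)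
    then show "\<exists>N. \<forall>m\<ge>N. \<forall>n\<ge>N. dist (Y m) (Y n) < e"
      by blast
  qed
  then obtain y where "Y \<longlonglongrightarrow> y"
    using convergent_eq_Cauchy by blast
  then show ?thesis
    using truncation_limit_levels[OF g] unfolding Y_def by blast
qed

lemma spectral_integral_unbounded:
  assumes f: "f ` space M \<subseteq> islice \<II>" and unb: "\<not> bounded (f ` space M)"
  shows "spectral_integral \<II> M E J f = (\<lambda>x.
      if (\<integral>\<^sup>+\<omega>. ennreal ((norm (proj (f \<omega>)))\<^sup>2) \<partial>emeas x) < \<infinity>
      then Some (THE y. truncation_limit (\<lambda>\<omega>. proj (f \<omega>)) x y) else None)"
proof -
  have "bounded ((\<lambda>\<omega>. proj (f \<omega>)) ` A) \<longleftrightarrow> bounded (f ` A)" if "A \<in> sets M" for A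
  proof
    assume "bounded ((\<lambda>\<omega>. proj (f \<omega>)) ` A)"
    moreover have "norm (proj (f \<omega>)) = norm (f \<omega>)" if "\<omega> \<in> A" for \<omega>
      using f that sets.sets_into_space[OF \<open>A \<in> sets M\<close>] by (intro norm_proj) blast
    ultimately show "bounded (f ` A)"
      by (auto simp: bounded_iff)
  qed (rule bounded_proj_image)
  then have "(\<forall>j. S j \<in> bsets (\<lambda>\<omega>. proj (f \<omega>)) \<and> S j \<subseteq> S (Suc j)) \<longleftrightarrow>
      (\<forall>j. S j \<in> sets M \<and> S j \<subseteq> S (Suc j) \<and> bounded (f ` S j))" for S :: "nat \<Rightarrow> 'n clifford set"
    by (auto simp: bsets_def)
  moreover have "(\<integral>\<^sup>+\<omega>. ennreal ((norm (proj (f \<omega>)))\<^sup>2) \<partial>emeas x) =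
      (\<integral>\<^sup>+\<omega>. ennreal ((norm (f \<omega>))\<^sup>2) \<partial>emeas x)" for x
  proof (rule nn_integral_cong)
    fix \<omega> assume "\<omega> \<in> space (emeas x)"
    then have "f \<omega> \<in> islice \<II>"
      using f by auto
    then show "ennreal ((norm (proj (f \<omega>)))\<^sup>2) = ennreal ((norm (f \<omega>))\<^sup>2)"
      by (simp only: norm_proj)
  qed
  ultimately show ?thesis
    using unb by (simp only: spectral_integral_def truncation_limit_def
        bounded_integral_op_indicator[OF f] scalar_measure_eq_emeas if_False conj_assoc)
qed

text \<open>The finite measure \<open>emeas x\<close> is concentrated on \<open>A\<close>, where
  \<open>g\<close> is bounded.\<close>

lemma nn_integral_finite_if_localized:
  assumes g: "g \<in> borel_measurable M" and A: "A \<in> bsets g" and x: "E A x = x"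
  shows "(\<integral>\<^sup>+\<omega>. ennreal ((norm (g \<omega>))\<^sup>2) \<partial>emeas x) < \<infinity>"
proof -
  have A': "A \<in> sets M"
    using A by (simp add: bsets_def)
  obtain C where C: "\<forall>z\<in>g ` A. norm z \<le> C"
    using A by (auto simp: bsets_def bounded_iff)
  have "E (space M - A) x = 0"
    using E_disjoint[of "space M - A" A x] A' x by auto
  then have "emeasure (emeas x) (space M - A) = 0"
    using A' by (simp add: emeasure_emeas)
  then have "AE \<omega> in emeas x. \<omega> \<in> A"
    using A' by (intro AE_I[of _ _ "space M - A"]) auto
  then have "(\<integral>\<^sup>+\<omega>. ennreal ((norm (g \<omega>))\<^sup>2) \<partial>emeas x) \<le> (\<integral>\<^sup>+\<omega>. ennreal (C\<^sup>2) \<partial>emeas x)"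
    using C by (intro nn_integral_mono_AE) (auto intro!: ennreal_leI power_mono elim!: eventually_mono)
  also have "\<dots> < \<infinity>"
    by (simp add: emeasure_emeas ennreal_mult_less_top)
  finally show ?thesis .
qed

text \<open>This is where the integral, bounded or not, is brought under \<open>acts_as\<close>. In
  the unbounded case a vector of the domain has a truncation limit, described by
  \<open>truncation_limit_E\<close>, and localised vectors lie in the domain.\<close>

lemma spectral_integral_acts_as:
  assumes f: "f \<in> borel_measurable M" "f ` space M \<subseteq> islice \<II>"
  shows "acts_as (bsets (\<lambda>\<omega>. proj (f \<omega>))) (spectral_integral \<II> M E J f) (\<lambda>\<omega>. proj (f \<omega>))"
proof -
  let ?g = "\<lambda>\<omega>. proj (f \<omega>)" and ?T = "spectral_integral \<II> M E J f"
  have g: "?g \<in> borel_measurable M"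
    using f(1) by (rule measurable_proj)
  show ?thesis
    unfolding acts_as_def
  proof (intro ballI conjI allI impI)
    fix A x assume A: "A \<in> bsets ?g"
    then have A': "A \<in> sets M"
      by (simp add: bsets_def)
    show "E A (the (?T x)) = cint (\<lambda>\<omega>. indicator A \<omega> * ?g \<omega>) x" if x: "x \<in> dom ?T"
    proof (cases "bounded (f ` space M)")
      case True
      then have "?g \<in> bmf"
        using g by (simp add: bmf_def bounded_proj_image)
      then show ?thesis
        using True f A'
        by (simp add: spectral_integral_def total_op_def bounded_integral_op_eq_cint E_cint)
    next
      case False
      note T = spectral_integral_unbounded[OF f(2) False]
      have "(\<integral>\<^sup>+\<omega>. ennreal ((norm (?g \<omega>))\<^sup>2) \<partial>emeas x) < \<infinity>"
        using x unfolding T by (auto split: if_splits)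
      moreover from this have "\<exists>!y. truncation_limit ?g x y"
        using truncation_limit_exists[OF g] truncation_limit_unique[OF g] by blast
      then have "truncation_limit ?g x (THE y. truncation_limit ?g x y)"
        by (rule theI')
      ultimately show ?thesis
        unfolding T using truncation_limit_E[OF g _ A] by simp
    qed
    show "?T x = Some (cint (\<lambda>\<omega>. indicator A \<omega> * ?g \<omega>) x)" if x: "E A x = x"
    proof (cases "bounded (f ` space M)")
      case True
      then have "?g \<in> bmf"
        using g by (simp add: bmf_def bounded_proj_image)
      then show ?thesis
        using True f E_cint(2)[OF A', of ?g x] x
        by (simp add: spectral_integral_def total_op_def bounded_integral_op_eq_cint)
    next
      case False
      \<comment> \<open>For localised \<open>x\<close> the truncated integrals are the localisations
        of one fixed vector, so they converge to it.\<close>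
      have "cint (\<lambda>\<omega>. indicator (levels ?g k) \<omega> * ?g \<omega>) x =
          E (levels ?g k) (cint (\<lambda>\<omega>. indicator A \<omega> * ?g \<omega>) x)" for k
        using cint_indicator_Int(1)[OF g levels_bsets[OF g] A, of k x] x by simp
      then have "truncation_limit ?g x (cint (\<lambda>\<omega>. indicator A \<omega> * ?g \<omega>) x)"
        using levels_tendsto[OF g] by (intro truncation_limit_levels[OF g]) simp
      then have "(THE y. truncation_limit ?g x y) = cint (\<lambda>\<omega>. indicator A \<omega> * ?g \<omega>) x"
        using truncation_limit_unique[OF g] by blast
      then show ?thesis
        unfolding spectral_integral_unbounded[OF f(2) False]
        using nn_integral_finite_if_localized[OF g A x] by simp
    qed
  qed
qed

end

section \<open>The symbol of the quadratic operator\<close>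

definition char_quad :: "complex \<Rightarrow> complex \<Rightarrow> complex"
  where "char_quad c z = (z - c) * (z - cnj c)"

lemma char_quad_altdef: "char_quad c z = z\<^sup>2 - of_real (2 * Re c) * z + of_real ((norm c)\<^sup>2)"
proof -
  have "char_quad c z = z\<^sup>2 - (c + cnj c) * z + c * cnj c"
    by (simp add: char_quad_def algebra_simps power2_eq_square)
  then show ?thesis
    by (simp only: complex_add_cnj complex_norm_square)
qed

lemma norm_char_quad_cnj: "norm (char_quad c (cnj z)) = norm (char_quad c z)"
proof -
  have "char_quad c (cnj z) = cnj (char_quad c z)"
    by (simp add: char_quad_def mult.commute)
  then show ?thesis
    by simp
qed

text \<open>Both roots have modulus |c|, so each factor is at least the difference of the moduli.
  This confines the sets where the symbol is small to an annulus.\<close>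

lemma norm_char_quad_ge: "(norm z - norm c)\<^sup>2 \<le> norm (char_quad c z)"
proof -
  have "\<bar>norm z - norm c\<bar> * \<bar>norm z - norm c\<bar> \<le> norm (z - c) * norm (z - cnj c)"
    using norm_triangle_ineq3[of z c] norm_triangle_ineq3[of z "cnj c"] by (intro mult_mono) auto
  then show ?thesis
    by (simp add: char_quad_def norm_mult power2_eq_square)
qed

section \<open>The S-spectrum as an essential range\<close>

context clifford_calculus
begin

lemma Q_op_emb: "Q_op (emb c) T = quad (Re c) ((norm c)\<^sup>2) T"
  unfolding Q_op_def quad_def norm_emb by (simp add: emb_def cRe_ipoint \<II>)

text \<open>If some sublevel set of the symbol is null, integrating its reciprocal yields a bounded
  inverse and a dense range. Otherwise vectors localised in small sublevel sets violate every bound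
  on the inverse.\<close>

lemma S_spectrum_iff_essential_range:
  fixes T :: "('h, 'n) op"
  assumes g: "g \<in> borel_measurable M" and T: "acts_as (bsets g) T g"
  shows "emb c \<in> S_spectrum T \<longleftrightarrow> (\<forall>d>0. E {\<omega> \<in> space M. norm (char_quad c (g \<omega>)) < d} \<noteq> 0)"
    (is "_ \<longleftrightarrow> ?ess")
proof -
  let ?p = "\<lambda>\<omega>. char_quad c (g \<omega>)" and ?Q = "Q_op (emb c) T"
  have p: "?p \<in> borel_measurable M"
    unfolding char_quad_def using g by measurable
  have Q: "acts_as (bsets g) ?Q ?p"
    unfolding Q_op_emb char_quad_altdef using g T by (rule acts_as_quad)
  have pg: "bounded (?p ` A)" if A: "A \<in> bsets g" for A
  proof -
    obtain C where C: "\<And>\<omega>. \<omega> \<in> A \<Longrightarrow> norm (g \<omega>) \<le> C"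
      using A by (auto simp: bsets_def bounded_iff)
    have "norm (?p \<omega>) \<le> (C + norm c) * (C + norm c)" if "\<omega> \<in> A" for \<omega>
      unfolding char_quad_def norm_mult
      using norm_triangle_ineq4[of "g \<omega>" c] norm_triangle_ineq4[of "g \<omega>" "cnj c"] C[OF that]
        order_trans[OF norm_ge_zero C[OF that]]
      by (intro mult_mono) auto
    then show ?thesis
      by (auto simp: bounded_iff)
  qed
  \<comment> \<open>The symbol grows quadratically in |g|, so \<open>g\<close> is bounded where the
    symbol is small. Hence localisation to sublevel sets is possible even if \<open>g\<close> is
    unbounded.\<close>
  have sub: "{\<omega> \<in> space M. norm (?p \<omega>) < d} \<in> bsets g" for d
  proof -
    have "norm (g \<omega>) \<le> norm c + 1 + \<bar>d\<bar>" if "norm (?p \<omega>) < d" for \<omega>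
    proof (rule ccontr)
      assume "\<not> ?thesis"
      then have "1 + \<bar>d\<bar> < norm (g \<omega>) - norm c"
        by simp
      then have "(1 + \<bar>d\<bar>)\<^sup>2 \<le> (norm (g \<omega>) - norm c)\<^sup>2"
        by (intro power_mono) auto
      then have "(1 + \<bar>d\<bar>)\<^sup>2 < d"
        using norm_char_quad_ge[of "g \<omega>" c] that by linarith
      moreover have "\<bar>d\<bar> \<le> (1 + \<bar>d\<bar>)\<^sup>2"
        by (simp add: power2_eq_square algebra_simps)
      ultimately show False
        by linarith
    qed
    then show ?thesis
      using sublevel_sets[OF g p pg Q] unfolding bsets_def bounded_iff by blast
  qed
  have paravector: "emb c \<in> paravectors"
    unfolding emb_def using \<II> by (rule ipoint_paravector)
  show ?thesis
  proof
    assume "emb c \<in> S_spectrum T"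
    show ?ess
    proof (intro allI impI notI)
      fix d :: real assume d: "d > 0" "E {\<omega> \<in> space M. norm (?p \<omega>) < d} = 0"
      obtain B where B: "\<forall>x y. ?Q x = Some y \<longrightarrow> B y = x" "bounded_linear B"
          and dense: "closure (ran ?Q) = UNIV"
        using inverse_if_symbol_bounded_below[OF g p pg Q d] .
      have inv: "inverse_op ?Q y = Some (B y)" if "y \<in> ran ?Q" for y
      proof -
        obtain x where x: "?Q x = Some y"
          using \<open>y \<in> ran ?Q\<close> by (auto simp: ran_def)
        then have "(THE x. ?Q x = Some y) = B y"
          using B(1) by (intro the_equality) auto
        then show ?thesis
          using that by (simp add: inverse_op_def)
      qed
      obtain K where K: "\<And>y. norm (B y) \<le> norm y * K"
        using bounded_linear.bounded[OF B(2)] by blast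
      have "norm (the (inverse_op ?Q y)) \<le> K * norm y" if "y \<in> dom (inverse_op ?Q)" for y
      proof -
        have "y \<in> ran ?Q"
          using that by (auto simp: inverse_op_def split: if_splits)
        then show ?thesis
          using inv K[of y] by (simp add: mult.commute)
      qed
      then have "bounded_op (inverse_op ?Q)"
        unfolding bounded_op_def by blast
      moreover have "\<forall>x. ?Q x = Some 0 \<longrightarrow> x = 0"
        using B linear_simps(3) by metis
      ultimately have "emb c \<in> S_resolvent_set T"
        using paravector dense by (simp add: S_resolvent_set_def)
      then show False
        using \<open>emb c \<in> S_spectrum T\<close> by (simp add: S_spectrum_def)
    qed
  next
    assume ess: ?ess
    have "emb c \<notin> S_resolvent_set T"
    proof
      assume res: "emb c \<in> S_resolvent_set T"
      then have bounded: "bounded_op (inverse_op ?Q)" and ker: "\<And>x. ?Q x = Some 0 \<Longrightarrow> x = 0"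
        by (simp_all add: S_resolvent_set_def)
      obtain C where C: "\<And>y. y \<in> dom (inverse_op ?Q) \<Longrightarrow> norm (the (inverse_op ?Q y)) \<le> C * norm y"
        using bounded unfolding bounded_op_def by blast
      have "\<exists>x y. ?Q x = Some y \<and> norm x > C * norm y"
      proof (rule not_bounded_below_if_essential_zero[OF g p pg Q _ sub])
        show "E {\<omega> \<in> space M. norm (?p \<omega>) < d} \<noteq> 0" if "d > 0" for d
          using ess that by blast
      qed
      then obtain x y where xy: "?Q x = Some y" "norm x > C * norm y"
        by blast
      \<comment> \<open>\<open>inverse_op\<close> picks a preimage by definite description, so
        injectivity of \<open>?Q\<close> is needed; it comes from the trivial kernel.\<close>
      have "(THE x. ?Q x = Some y) = x"
        using inj_if_kernel_trivial[OF g p pg Q ker _ xy(1)] xy(1) by (intro the_equality)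
      then have "inverse_op ?Q y = Some x"
        using xy(1) by (auto simp: inverse_op_def ran_def)
      then have "norm x \<le> C * norm y"
        using C[of y] by (simp add: domI)
      then show False
        using xy(2) by simp
    qed
    then show "emb c \<in> S_spectrum T"
      using paravector by (simp add: S_spectrum_def)
  qed
qed

lemma S_spectrum_spectral_integral_iff:
  assumes f: "f \<in> borel_measurable M" "f ` space M \<subseteq> islice \<II>"
  shows "emb c \<in> S_spectrum (spectral_integral \<II> M E J f) \<longleftrightarrow>
    (\<forall>d>0. E {\<omega> \<in> space M. norm (char_quad c (proj (f \<omega>))) < d} \<noteq> 0)"
  using measurable_proj[OF f(1)] spectral_integral_acts_as[OF f] by (rule S_spectrum_iff_essential_range)

section \<open>Conjugation symmetry on the slice\<close>

lemma uminus_imag_unit: "- \<II> \<in> imag_sphere"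
proof -
  obtain c where c: "\<II> = (\<Sum>j\<in>UNIV. c j *\<^sub>R blade {j})" "(\<Sum>j\<in>UNIV. (c j)\<^sup>2) = 1"
    using \<II> unfolding imag_sphere_def by blast
  then show ?thesis
    unfolding imag_sphere_def by (intro CollectI exI[of _ "\<lambda>j. - c j"]) (simp add: sum_negf)
qed

text \<open>Conjugation in the slice replaces the unit \<open>\<II>\<close> by
  \<open>- \<II>\<close>, a special case of axial symmetry.\<close>

lemma emb_cnj_in:
  assumes "axially_symmetric \<Omega>" "emb z \<in> \<Omega>"
  shows "emb (cnj z) \<in> \<Omega>"
proof -
  have "ipoint (- \<II>) (Re z) (Im z) \<in> \<Omega>"
    using assms \<II> uminus_imag_unit unfolding axially_symmetric_def emb_def by blast
  then show ?thesis
    by (simp add: emb_def ipoint_def)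
qed

text \<open>Evenness of \<open>f0\<close> and oddness of \<open>f1\<close> in the second variable
  mean that \<open>f\<close> preserves the slice and commutes with conjugation on it.\<close>

lemma intrinsic_cnj:
  assumes f: "intrinsic_on \<Omega> f" and z: "emb z \<in> \<Omega>"
  obtains w where "f (emb z) = emb w" "f (emb (cnj z)) = emb (cnj w)"
proof -
  obtain f0 f1 :: "real \<Rightarrow> real \<Rightarrow> real" where
    f01: "\<And>u v. ipoint \<II> u v \<in> \<Omega> \<Longrightarrow> f (ipoint \<II> u v) = ipoint \<II> (f0 u v) (f1 u v) \<and>
      f0 u (- v) = f0 u v \<and> f1 u (- v) = - f1 u v"
    using f \<II> unfolding intrinsic_on_def by blast
  have "emb (cnj z) \<in> \<Omega>"
    using f z by (auto simp: intrinsic_on_def intro: emb_cnj_in)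
  then have "f (emb (cnj z)) = ipoint \<II> (f0 (Re z) (- Im z)) (f1 (Re z) (- Im z))"
    using f01[of "Re z" "- Im z"] by (simp add: emb_def)
  moreover have "f (emb z) = ipoint \<II> (f0 (Re z) (Im z)) (f1 (Re z) (Im z))"
      "f0 (Re z) (- Im z) = f0 (Re z) (Im z)" "f1 (Re z) (- Im z) = - f1 (Re z) (Im z)"
    using f01[of "Re z" "Im z"] z by (simp_all add: emb_def)
  ultimately show ?thesis
    by (intro that[of "Complex (f0 (Re z) (Im z)) (f1 (Re z) (Im z))"]) (simp_all add: emb_def)
qed

end

section \<open>The support of the spectral measure of \<open>T\<close>\<close>

lemma spectral_measure_of_calculus:
  assumes "\<II> \<in> imag_sphere" "spectral_measure_of \<II> T E J"
  shows "clifford_calculus (spectral_space \<II> T) E J \<II>"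
  using assms unfolding spectral_measure_of_def clifford_calculus_def clifford_calculus_axioms_def
  by (blast intro: spectral_calculus_Clifford)

lemma space_spectral_space: "space (spectral_space \<II> T) = S_spectrum T \<inter> ihalf \<II>"
  by (simp add: spectral_space_def space_restrict_space)

lemma measurable_spectral_space:
  "continuous_on (S_spectrum T) f \<Longrightarrow> f \<in> borel_measurable (spectral_space \<II> T)"
  unfolding spectral_space_def
  by (rule borel_measurable_continuous_on_restrict) (auto intro: continuous_on_subset)

context
  fixes T :: "('h::{real_inner,banach}, 'n::{finite,linorder}) op"
    and \<II> :: "'n clifford"
    and E :: "'n clifford set \<Rightarrow> ('h, 'n) bop"
    and J :: "('h, 'n) bop"
  assumes \<II>: "\<II> \<in> imag_sphere" and T: "spectral_measure_of \<II> T E J"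
begin

interpretation clifford_calculus "spectral_space \<II> T" E J \<II>
  using \<II> T by (rule spectral_measure_of_calculus)

lemma emb_in_ihalf: "emb z \<in> ihalf \<II> \<longleftrightarrow> 0 \<le> Im z"
proof
  assume "emb z \<in> ihalf \<II>"
  then obtain u v where "emb z = ipoint \<II> u v" "0 \<le> v"
    by (auto simp: ihalf_def)
  then show "0 \<le> Im z"
    using iIm_ipoint[OF \<II>] unfolding emb_def by metis
qed (auto simp: ihalf_def emb_def)

lemma ihalf_islice: "ihalf \<II> \<subseteq> islice \<II>"
  by (auto simp: ihalf_def islice_def)

lemma T_acts_as: "acts_as (bsets proj) T proj"
proof -
  have "T = spectral_integral \<II> (spectral_space \<II> T) E J (\<lambda>\<omega>. \<omega>)"
    using T by (simp add: spectral_measure_of_def)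
  moreover have "acts_as (bsets proj) (spectral_integral \<II> (spectral_space \<II> T) E J (\<lambda>\<omega>. \<omega>)) proj"
    using ihalf_islice
    by (intro spectral_integral_acts_as measurable_spectral_space) (auto simp: space_spectral_space)
  ultimately show ?thesis
    by simp
qed

lemma measurable_proj_id: "proj \<in> borel_measurable (spectral_space \<II> T)"
  using measurable_proj[OF measurable_spectral_space[OF continuous_on_id]] by simp

lemma spectral_support:
  "emb c \<in> S_spectrum T \<Longrightarrow> d > 0 \<Longrightarrow> E {\<omega> \<in> S_spectrum T \<inter> ihalf \<II>. norm (char_quad c (proj \<omega>)) < d} \<noteq> 0"
  using S_spectrum_iff_essential_range[OF measurable_proj_id T_acts_as, of c]
  unfolding space_spectral_space by blast

lemma sublevel_in_sets:
  fixes \<phi> :: "'n clifford \<Rightarrow> real"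
  assumes "continuous_on (S_spectrum T) \<phi>"
  shows "{\<omega> \<in> S_spectrum T \<inter> ihalf \<II>. \<phi> \<omega> < d} \<in> sets (spectral_space \<II> T)"
proof -
  have [measurable]: "\<phi> \<in> borel_measurable (spectral_space \<II> T)"
    using assms by (rule measurable_spectral_space)
  have "{\<omega> \<in> space (spectral_space \<II> T). \<phi> \<omega> < d} \<in> sets (spectral_space \<II> T)"
    by measurable
  then show ?thesis
    by (simp only: space_spectral_space)
qed

lemma continuous_on_char_quad_proj:
  assumes "continuous_on A f"
  shows "continuous_on A (\<lambda>\<omega>. norm (char_quad c (proj (f \<omega>))))"
  unfolding char_quad_def
  by (intro continuous_intros bounded_linear.continuous_on[OF bounded_linear_proj] assms)

text \<open>Points z and c of the closed upper half-plane satisfy |z - c| \<le> |z - cnj c|, so |z -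
  c|^2 is at most the modulus of the symbol. The sublevel set for \<open>e\<^sup>2\<close>, which is
  not null for spectral c, thus lies in the ball of radius \<open>e\<close>.\<close>

lemma E_neighbourhood:
  assumes c: "emb c \<in> S_spectrum T \<inter> ihalf \<II>" and "e > 0"
  shows "E {\<omega> \<in> S_spectrum T \<inter> ihalf \<II>. dist \<omega> (emb c) < e} \<noteq> 0" (is "E ?B \<noteq> 0")
proof
  assume null: "E ?B = 0"
  let ?U = "{\<omega> \<in> S_spectrum T \<inter> ihalf \<II>. norm (char_quad c (proj \<omega>)) < e\<^sup>2}"
  have "?U \<subseteq> ?B"
  proof
    fix \<omega> assume \<omega>: "\<omega> \<in> ?U"
    then obtain z where z: "\<omega> = emb z"
      using ihalf_islice islice_iff by blast
    have "0 \<le> Im z" "0 \<le> Im c"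
      using \<omega> c z emb_in_ihalf by auto
    then have "(norm (z - c))\<^sup>2 \<le> (norm (z - cnj c))\<^sup>2"
      unfolding cmod_power2 by (simp add: power2_eq_square algebra_simps)
    then have "norm (z - c) \<le> norm (z - cnj c)"
      by (rule power2_le_imp_le) simp
    then have "(norm (z - c))\<^sup>2 \<le> norm (char_quad c z)"
      by (simp add: char_quad_def norm_mult power2_eq_square mult_left_mono)
    also have "\<dots> < e\<^sup>2"
      using \<omega> z by simp
    finally have "norm (z - c) < e"
      using \<open>e > 0\<close> by (simp add: power_less_imp_less_base)
    then show "\<omega> \<in> ?B"
      using \<omega> z by (simp add: dist_norm[of z c])
  qed
  moreover have "?U \<in> sets (spectral_space \<II> T)"
    by (intro sublevel_in_sets continuous_on_char_quad_proj continuous_on_id)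
  moreover have "?B \<in> sets (spectral_space \<II> T)"
    by (intro sublevel_in_sets continuous_intros)
  ultimately have "E ?U = 0"
    using null by (intro E_null_subset[of ?U ?B])
  then show False
    using spectral_support[of c "e\<^sup>2"] c \<open>e > 0\<close> by simp
qed

section \<open>Spectral mapping for continuous intrinsic functions\<close>

lemma essential_range_iff_closure:
  assumes f: "intrinsic_on (S_spectrum T) f" "continuous_on (S_spectrum T) f"
  shows "(\<forall>d>0. E {\<omega> \<in> S_spectrum T \<inter> ihalf \<II>. norm (char_quad c (proj (f \<omega>))) < d} \<noteq> 0) \<longleftrightarrow>
    emb c \<in> closure (f ` (S_spectrum T \<inter> islice \<II>))" (is "?ess \<longleftrightarrow> ?cl")
proof
  assume ?cl
  show ?ess
  proof (intro allI impI)
    fix d :: real assume "d > 0"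
    \<comment> \<open>The symbol vanishes at c, so values of \<open>f\<close> close to c make it
      small.\<close>
    have "((\<lambda>w. norm (char_quad c w)) \<longlongrightarrow> norm (char_quad c c)) (nhds c)"
      unfolding char_quad_def by (intro tendsto_intros filterlim_ident)
    moreover have "norm (char_quad c c) < d"
      using \<open>d > 0\<close> by (simp add: char_quad_def)
    ultimately have "\<forall>\<^sub>F w in nhds c. norm (char_quad c w) < d"
      by (rule order_tendstoD(2))
    then obtain \<eta> where \<eta>: "\<eta> > 0" "\<And>w. dist w c < \<eta> \<Longrightarrow> norm (char_quad c w) < d"
      unfolding eventually_nhds_metric by blast
    obtain y where y: "y \<in> S_spectrum T \<inter> islice \<II>" "dist (f y) (emb c) < \<eta>"
      using \<open>?cl\<close> \<eta>(1) unfolding closure_approachable by blast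
    obtain z where "y = emb z"
      using y(1) islice_iff by blast
    then have z: "emb z \<in> S_spectrum T" "dist (f (emb z)) (emb c) < \<eta>"
      using y by simp_all
    obtain w where w: "f (emb z) = emb w" "f (emb (cnj z)) = emb (cnj w)"
      using intrinsic_cnj[OF f(1) z(1)] .
    have small: "norm (char_quad c w) < d"
      using \<eta>(2) z(2) w(1) by simp
    \<comment> \<open>\<open>E\<close> lives on the upper half of the slice only. Moving to the
      conjugate point conjugates the value of \<open>f\<close> and leaves the modulus of the symbol
      unchanged.\<close>
    define z' where "z' = (if 0 \<le> Im z then z else cnj z)"
    let ?\<phi> = "\<lambda>\<omega>. norm (char_quad c (proj (f \<omega>)))"
    have z': "emb z' \<in> S_spectrum T \<inter> ihalf \<II>"
      using z(1) emb_cnj_in[OF axially_symmetric_S_spectrum z(1)]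
      by (simp add: z'_def emb_in_ihalf)
    have "0 < d - ?\<phi> (emb z')"
      using small w by (simp add: z'_def norm_char_quad_cnj)
    then obtain e where e: "e > 0"
        "\<And>\<omega>. \<omega> \<in> S_spectrum T \<Longrightarrow> dist \<omega> (emb z') < e \<Longrightarrow> dist (?\<phi> \<omega>) (?\<phi> (emb z')) < d - ?\<phi> (emb z')"
      using continuous_on_char_quad_proj[OF f(2), of c] z' unfolding continuous_on_iff by blast
    let ?B = "{\<omega> \<in> S_spectrum T \<inter> ihalf \<II>. dist \<omega> (emb z') < e}"
    let ?U = "{\<omega> \<in> S_spectrum T \<inter> ihalf \<II>. ?\<phi> \<omega> < d}"
    have "?B \<subseteq> ?U"
    proof
      fix \<omega> assume \<omega>: "\<omega> \<in> ?B"
      then have "dist (?\<phi> \<omega>) (?\<phi> (emb z')) < d - ?\<phi> (emb z')"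
        using e(2) by blast
      then have "?\<phi> \<omega> < d"
        unfolding dist_real_def by linarith
      then show "\<omega> \<in> ?U"
        using \<omega> by blast
    qed
    moreover have "?U \<in> sets (spectral_space \<II> T)"
      by (intro sublevel_in_sets continuous_on_char_quad_proj f(2))
    moreover have "?B \<in> sets (spectral_space \<II> T)"
      by (intro sublevel_in_sets continuous_intros)
    ultimately show "E ?U \<noteq> 0"
      using E_null_subset[of ?B ?U] E_neighbourhood[OF z' e(1)] by blast
  qed
next
  assume ?ess
  show ?cl
  proof (rule ccontr)
    assume "\<not> ?cl"
    then obtain d where d: "d > 0"
        "\<And>\<omega>. \<omega> \<in> S_spectrum T \<Longrightarrow> \<omega> \<in> islice \<II> \<Longrightarrow> d \<le> dist (f \<omega>) (emb c)"
      unfolding closure_approachable not_ex not_all not_imp by (auto simp: not_less)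
    \<comment> \<open>The value w at a spectral point and its conjugate, the value at the conjugate
      point, both keep distance d from c. As |cnj w - c| = |w - cnj c|, each factor of the symbol is
      at least d.\<close>
    have "d\<^sup>2 \<le> norm (char_quad c (proj (f \<omega>)))" if \<omega>: "\<omega> \<in> S_spectrum T \<inter> ihalf \<II>" for \<omega>
    proof -
      obtain z where z: "\<omega> = emb z"
        using \<omega> ihalf_islice islice_iff by blast
      obtain w where w: "f (emb z) = emb w" "f (emb (cnj z)) = emb (cnj w)"
        using intrinsic_cnj[OF f(1), of z] \<omega> z by blast
      have "d \<le> norm (w - c)"
        using d(2)[of "emb z"] \<omega> z w by (simp add: dist_norm[of w c])
      moreover have "d \<le> norm (cnj w - c)"
        using d(2)[of "emb (cnj z)"] emb_cnj_in[OF axially_symmetric_S_spectrum, of z T] \<omega> z w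
        by (simp add: dist_norm[of "cnj w" c])
      moreover have "norm (cnj w - c) = norm (w - cnj c)"
        by (metis complex_cnj_cnj complex_cnj_diff complex_mod_cnj)
      ultimately have "d * d \<le> norm (w - c) * norm (w - cnj c)"
        using d(1) by (intro mult_mono) auto
      then show ?thesis
        by (simp add: z w char_quad_def norm_mult power2_eq_square)
    qed
    then have empty: "{\<omega> \<in> S_spectrum T \<inter> ihalf \<II>. norm (char_quad c (proj (f \<omega>))) < d\<^sup>2} = {}"
      by (auto simp: not_less)
    have "E {\<omega> \<in> S_spectrum T \<inter> ihalf \<II>. norm (char_quad c (proj (f \<omega>))) < d\<^sup>2} \<noteq> 0"
      using \<open>?ess\<close> d(1) by simp
    then show False
      unfolding empty by simp
  qed
qed

lemma S_spectrum_spectral_integral: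
  assumes f: "intrinsic_on (S_spectrum T) f" "continuous_on (S_spectrum T) f"
  shows "S_spectrum (spectral_integral \<II> (spectral_space \<II> T) E J f) \<inter> islice \<II> =
    closure (f ` (S_spectrum T \<inter> islice \<II>))"
proof -
  have f_islice: "f ` (S_spectrum T \<inter> islice \<II>) \<subseteq> islice \<II>"
  proof
    fix c assume "c \<in> f ` (S_spectrum T \<inter> islice \<II>)"
    then obtain z where "c = f (emb z)" "emb z \<in> S_spectrum T"
      using islice_iff by auto
    then show "c \<in> islice \<II>"
      using intrinsic_cnj[OF f(1), of z] by (metis emb_islice)
  qed
  \<comment> \<open>With the closure inside the slice, the two sets need to be compared only at
    points \<open>emb c\<close>.\<close>
  then have "closure (f ` (S_spectrum T \<inter> islice \<II>)) \<subseteq> islice \<II>"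
    using closed_islice by (rule closure_minimal)
  moreover have "f ` space (spectral_space \<II> T) \<subseteq> islice \<II>"
    using f_islice ihalf_islice by (auto simp: space_spectral_space)
  then have "emb c \<in> S_spectrum (spectral_integral \<II> (spectral_space \<II> T) E J f) \<longleftrightarrow>
      emb c \<in> closure (f ` (S_spectrum T \<inter> islice \<II>))" for c
    using S_spectrum_spectral_integral_iff[OF measurable_spectral_space[OF f(2)], of c]
    unfolding essential_range_iff_closure[OF f, symmetric] space_spectral_space by blast
  ultimately have "c \<in> S_spectrum (spectral_integral \<II> (spectral_space \<II> T) E J f) \<inter> islice \<II> \<longleftrightarrow>
      c \<in> closure (f ` (S_spectrum T \<inter> islice \<II>))" for c
  proof (cases "c \<in> islice \<II>")
    case True
    then obtain z where "c = emb z"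
      using islice_iff by blast
    then show ?thesis
      using \<open>\<And>c. emb c \<in> S_spectrum (spectral_integral \<II> (spectral_space \<II> T) E J f) \<longleftrightarrow>
          emb c \<in> closure (f ` (S_spectrum T \<inter> islice \<II>))\<close> True by simp
  qed blast
  then show ?thesis
    by (rule set_eqI)
qed

section \<open>Compactness of the spectrum in the slice for bounded operators\<close>

lemma bounded_S_spectrum_slice:
  assumes "T \<in> bounded_ops"
  shows "bounded (S_spectrum T \<inter> islice \<II>)"
proof -
  obtain K where K: "\<And>x. norm (the (T x)) \<le> K * norm x"
    using assms unfolding bounded_ops_def bounded_op_def by auto
  \<comment> \<open>A spectral point of larger modulus would give nonzero vectors localised where
    the modulus of the symbol \<open>proj\<close> of \<open>T\<close> exceeds |K|; such vectors are
    stretched by more than the bound on \<open>T\<close> allows.\<close>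
  have "norm c \<le> \<bar>K\<bar> + 1" if c: "emb c \<in> S_spectrum T" for c
  proof (rule ccontr)
    assume large: "\<not> norm c \<le> \<bar>K\<bar> + 1"
    \<comment> \<open>On the set \<open>?U\<close> the modulus of \<open>proj\<close> differs from
      |c| by less than 1, so \<open>m\<close> bounds it from below.\<close>
    define m where "m = norm c - 1"
    have m: "\<bar>K\<bar> < m"
      using large by (simp add: m_def)
    let ?U = "{\<omega> \<in> S_spectrum T \<inter> ihalf \<II>. norm (char_quad c (proj \<omega>)) < 1}"
    have U: "\<bar>norm (proj \<omega>) - norm c\<bar> < 1" if "\<omega> \<in> ?U" for \<omega>
      using norm_char_quad_ge[of "proj \<omega>" c] that abs_square_less_1 by fastforce
    have U_sets: "?U \<in> sets (spectral_space \<II> T)"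
      by (intro sublevel_in_sets continuous_on_char_quad_proj continuous_on_id)
    have "norm (proj \<omega>) \<le> norm c + 1" if "\<omega> \<in> ?U" for \<omega>
      using U[OF that] by linarith
    then have U_bsets: "?U \<in> bsets proj"
      using U_sets unfolding bsets_def bounded_iff by blast
    obtain x0 where "E ?U x0 \<noteq> 0"
      using spectral_support[OF c, of 1] blinfun_eqI[of "E ?U" 0] by auto
    define x where "x = E ?U x0"
    have x: "x \<noteq> 0" "E ?U x = x"
      using \<open>E ?U x0 \<noteq> 0\<close> U_sets by (simp_all add: x_def E_idem)
    let ?g = "\<lambda>\<omega>. indicator ?U \<omega> * proj \<omega>"
    \<comment> \<open>The integral of \<open>h\<close> inverts \<open>T\<close> on the range of
      \<open>E ?U\<close> and has norm at most 1/m.\<close>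
    define h where "h = (\<lambda>\<omega>. indicator ?U \<omega> * inverse (proj \<omega>))"
    have h_le: "norm (h \<omega>) \<le> inverse m" for \<omega>
    proof (cases "\<omega> \<in> ?U")
      case True
      then have "m \<le> norm (proj \<omega>)"
        using U[OF True] by (simp add: m_def)
      then show ?thesis
        using True m by (simp add: h_def norm_inverse le_imp_inverse_le)
    next
      case False
      then show ?thesis
        using m by (simp add: h_def)
    qed
    have h: "h \<in> bmf"
    proof (rule bmfI[OF _ h_le])
      show "h \<in> borel_measurable (spectral_space \<II> T)"
        unfolding h_def using U_sets measurable_proj_id by measurable
    qed
    have "norm x \<le> inverse m * norm (the (T x))"
    proof -
      have "T x = Some (cint ?g x)"
        using acts_asD2[OF T_acts_as U_bsets x(2)] .
      moreover have "cint h (cint ?g x) = cint (\<lambda>\<omega>. h \<omega> * ?g \<omega>) x"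
        using h U_sets U_bsets measurable_proj_id
        by (intro cint_mult[symmetric] bmf_indicator_mult) (auto simp: bsets_def)
      moreover have "cint (\<lambda>\<omega>. h \<omega> * ?g \<omega>) = cint (indicator ?U)"
      proof (rule cint_cong)
        fix \<omega>
        have "proj \<omega> \<noteq> 0" if "\<omega> \<in> ?U"
          using U[OF that] m by (auto simp: m_def)
        then show "h \<omega> * ?g \<omega> = indicator ?U \<omega>"
          by (cases "\<omega> \<in> ?U") (simp_all add: h_def)
      qed
      ultimately have "x = cint h (the (T x))"
        using x(2) cint_indicator[OF U_sets] by simp
      then show ?thesis
        using norm_cint_le[OF h h_le, of "the (T x)"] m by simp
    qed
    also have "\<dots> \<le> inverse m * (K * norm x)"
      using K m by (intro mult_left_mono) auto
    also have "\<dots> = (K / m) * norm x"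
      by (simp add: field_simps)
    also have "\<dots> < 1 * norm x"
      using x(1) m by (intro mult_strict_right_mono) auto
    finally show False
      by simp
  qed
  then show ?thesis
    unfolding bounded_iff using islice_iff by (metis IntE norm_emb)
qed

text \<open>The spectral mapping identity for the identity function, whose integral is
  \<open>T\<close> itself, says that the set equals its closure.\<close>

lemma closed_S_spectrum_slice: "closed (S_spectrum T \<inter> islice \<II>)"
proof -
  have "intrinsic_on (S_spectrum T) (\<lambda>\<omega>. \<omega>)"
    unfolding intrinsic_on_def
    by (intro conjI axially_symmetric_S_spectrum exI[of _ "\<lambda>u v. u"] exI[of _ "\<lambda>u v. v"]) simp
  from S_spectrum_spectral_integral[OF this continuous_on_id]
  have "S_spectrum T \<inter> islice \<II> = closure (S_spectrum T \<inter> islice \<II>)"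
    using T by (simp add: spectral_measure_of_def)
  then show ?thesis
    using closed_closure by metis
qed

end

theorem theorem10p0p10:
  fixes T :: "('h::{real_inner,banach}, 'n::{finite,linorder}) op"
    and \<II> :: "'n clifford"
    and E :: "'n clifford set \<Rightarrow> ('h, 'n) bop"
    and J :: "('h, 'n) bop"
    and f :: "'n clifford \<Rightarrow> 'n clifford"
  assumes "normal_op T"
    and "\<II> \<in> imag_sphere"
    and "spectral_measure_of \<II> T E J"
    and "intrinsic_on (S_spectrum T) f"
    and "continuous_on (S_spectrum T) f"
    and "f \<in> borel_measurable (restrict_space borel (S_spectrum T))"
    and "bounded (f ` S_spectrum T)"
  shows "S_spectrum (spectral_integral \<II> (spectral_space \<II> T) E J f) \<inter> islice \<II> =
           closure (f ` (S_spectrum T \<inter> islice \<II>)) \<and>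
         (T \<in> bounded_ops \<longrightarrow>
           S_spectrum (spectral_integral \<II> (spectral_space \<II> T) E J f) \<inter> islice \<II> =
             f ` (S_spectrum T \<inter> islice \<II>))"
proof (intro conjI impI)
  show spectrum: "S_spectrum (spectral_integral \<II> (spectral_space \<II> T) E J f) \<inter> islice \<II> =
      closure (f ` (S_spectrum T \<inter> islice \<II>))"
    using assms(2-5) by (rule S_spectrum_spectral_integral)
  assume "T \<in> bounded_ops"
  \<comment> \<open>By continuity the image under \<open>f\<close> is then compact, hence equal to
    its closure.\<close>
  then have "compact (S_spectrum T \<inter> islice \<II>)"
    unfolding compact_eq_bounded_closed using assms(2,3)
    by (blast intro: bounded_S_spectrum_slice closed_S_spectrum_slice)
  moreover have "continuous_on (S_spectrum T \<inter> islice \<II>) f"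
    using assms(5) by (rule continuous_on_subset) blast
  ultimately have "closed (f ` (S_spectrum T \<inter> islice \<II>))"
    by (intro compact_imp_closed compact_continuous_image)
  then show "S_spectrum (spectral_integral \<II> (spectral_space \<II> T) E J f) \<inter> islice \<II> =
      f ` (S_spectrum T \<inter> islice \<II>)"
    unfolding spectrum by (rule closure_closed)
qed

end
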